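(* There exists an absolute constant $c_0>0$ such that the following holds. Let $n\geqslant 2$, let $r>s\geqslant 1$ be integers, let $\sigma\subseteq[n]$ with $|\sigma|=d<n$, let $(\sigma_1,\ldots,\sigma_r)$ be an $s$-uniform cover of $\sigma$, and let $d_i=|\sigma_i|$ (with the convention $0^0=1$). Then for every centered convex body $K$ in $\mathbb{R}^n$, $$\prod_{i=1}^r|K\cap E_{\sigma_i}|\leqslant \frac{(c_0d)^{ds}}{d_1^{d_1}\cdots d_r^{d_r}}\,|K\cap E_\sigma|^s\,|K|^{r-s}.$$ In particular, $\prod_{i=1}^r|K\cap E_{\sigma_i}|\leqslant \left(\frac{c_0r}{s}\right)^{ds}|K\cap E_\sigma|^s|K|^{r-s}$. *)

theory Defs
  imports "HOL-Analysis.Analysis"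
begin

definition Rn :: "nat \<Rightarrow> (nat \<Rightarrow> real) set" where
  "Rn n = PiE {1..n} (\<lambda>_. UNIV)"

abbreviation lebJ :: "nat set \<Rightarrow> (nat \<Rightarrow> real) measure" where
  "lebJ J \<equiv> PiM J (\<lambda>_. lborel)"

definition vol :: "nat \<Rightarrow> (nat \<Rightarrow> real) set \<Rightarrow> real" where
  "vol n K = measure (lebJ {1..n}) K"

definition E :: "nat \<Rightarrow> nat set \<Rightarrow> (nat \<Rightarrow> real) set" where
  "E n \<tau> = {x \<in> Rn n. \<forall>i\<in>\<tau>. x i = 0}"

text \<open>(n - card tau)-dimensional volume of the section K \<inter> E_tau, computed in
  the coordinates of [n] minus tau.\<close>
definition sec_vol :: "nat \<Rightarrow> (nat \<Rightarrow> real) set \<Rightarrow> nat set \<Rightarrow> real" where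
  "sec_vol n K \<tau> = measure (lebJ ({1..n} - \<tau>))
      ((\<lambda>x. restrict x ({1..n} - \<tau>)) ` (K \<inter> E n \<tau>))"

definition convex_body :: "nat \<Rightarrow> (nat \<Rightarrow> real) set \<Rightarrow> bool" where
  "convex_body n K \<longleftrightarrow>
     K \<subseteq> Rn n \<and> compact K \<and>
     (\<forall>x\<in>K. \<forall>y\<in>K. \<forall>t::real. 0 \<le> t \<and> t \<le> 1 \<longrightarrow>
         (\<lambda>i\<in>{1..n}. (1 - t) * x i + t * y i) \<in> K) \<and>
     (\<exists>x\<in>K. \<exists>e>0. \<forall>y\<in>Rn n. (\<forall>i\<in>{1..n}. \<bar>y i - x i\<bar> < e) \<longrightarrow> y \<in> K)"

definition centered_convex_body :: "nat \<Rightarrow> (nat \<Rightarrow> real) set \<Rightarrow> bool" where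
  "centered_convex_body n K \<longleftrightarrow> convex_body n K \<and>
     (\<forall>i\<in>{1..n}. set_lebesgue_integral (lebJ {1..n}) K (\<lambda>x. x i) = 0)"

definition uniform_cover :: "nat \<Rightarrow> nat set \<Rightarrow> nat \<Rightarrow> (nat \<Rightarrow> nat set) \<Rightarrow> bool" where
  "uniform_cover s \<sigma> r \<sigma>s \<longleftrightarrow>
     (\<forall>i<r. \<sigma>s i \<subseteq> \<sigma>) \<and> (\<forall>j\<in>\<sigma>. card {i. i < r \<and> j \<in> \<sigma>s i} = s)"

end

theory Submission
  imports Defs
begin

text \<open>
  The volumes \<open>f y\<close> of the sections of \<open>K\<close> parallel to \<open>E_\<sigma>\<close> form a log-concave function on
  the coordinate space of \<open>\<sigma>\<close>. It has its centroid at the origin, its integral is \<open>|K|\<close>, its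
  value at \<open>0\<close> is \<open>|K \<inter> E_\<sigma>|\<close>, and \<open>|K \<inter> E_{\<sigma>_i}|\<close> is its integral over the
  coordinates \<open>\<tau>_i = \<sigma> - \<sigma>_i\<close>. The sets \<open>\<tau>_i\<close> cover \<open>\<sigma>\<close> uniformly \<open>m = r - s\<close>
  times, so Barthe's reverse Brascamp--Lieb inequality for coordinate subspaces (an iteration of
  the one-dimensional Prekopa--Leindler inequality) applied with \<open>h x = f (m x / r) powr (r / m)\<close>
  bounds the product of these integrals by \<open>(r/m)^(dm) (max f)^s |K|^m\<close>, and
  \<open>(r/m)^m \<le> exp s\<close>.

  It remains to see that \<open>max f \<le> 4^d f 0\<close>. Log-concavity provides a vector \<open>u\<close> with
  \<open>f x \<le> f 0 * exp \<langle>u, x\<rangle>\<close>, whence \<open>sqrt (f x) \<ge> f x / sqrt (f 0) * (1 - \<langle>u, x\<rangle> / 2)\<close>.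
  Multiply by \<open>sqrt (f x0)\<close>, bound the left-hand side by \<open>f ((x + x0) / 2)\<close> and integrate: the
  linear term vanishes and \<open>sqrt (f x0 / f 0) \<le> 2^d\<close> remains. The constant is \<open>c0 = 4 e\<close>, because
  the product of the \<open>d_i ^ d_i\<close> is at most \<open>d ^ (d s)\<close>.
\<close>

section \<open>The one-dimensional Prekopa--Leindler inequality\<close>

text \<open>The one-dimensional Brunn-Minkowski inequality for compact sets, adding one summand at a
  time. Compactness is part of the induction because it supplies the extreme points of the partial
  sumset and makes the sumset measurable.\<close>

lemma weighted_sumset_compact:
  fixes A :: "'i \<Rightarrow> real set" and c :: "'i \<Rightarrow> real"
  assumes "finite I" "\<And>i. i \<in> I \<Longrightarrow> compact (A i)" "\<And>i. i \<in> I \<Longrightarrow> A i \<noteq> {}"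
    "\<And>i. i \<in> I \<Longrightarrow> c i > 0"
  defines "S \<equiv> \<lambda>I. {\<Sum>i\<in>I. c i * t i |t. \<forall>i\<in>I. t i \<in> A i}"
  shows "compact (S I) \<and> S I \<noteq> {} \<and> (\<Sum>i\<in>I. c i * measure lborel (A i)) \<le> measure lborel (S I)"
  using assms(1-4)
proof (induction I rule: finite_induct)
  case empty
  then show ?case by (simp add: S_def)
next
  case (insert j I)
  have IH: "compact (S I)" "S I \<noteq> {}" 
    "(\<Sum>i\<in>I. c i * measure lborel (A i)) \<le> measure lborel (S I)"
    using insert by auto
  define B where "B = (\<lambda>x. c j * x) ` A j"
  have cB: "compact B" "B \<noteq> {}"
    using insert.prems unfolding B_def by (auto intro!: compact_continuous_image continuous_intros)
  have cj: "c j > 0" using insert by auto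
  have mB: "measure lborel B = c j * measure lborel (A j)"
  proof -
    have "measure lebesgue ((\<lambda>x. c j *\<^sub>R x) ` A j) = \<bar>c j\<bar> ^ DIM(real) * measure lebesgue (A j)"
      using measure_lebesgue_affine [of "c j" 0 "A j"] by simp
    moreover have "closed (A j)" using insert by (auto intro: compact_imp_closed)
    ultimately show ?thesis
      using cj cB unfolding B_def by (simp add: compact_imp_closed)
  qed
  have S: "S (insert j I) = {x + y |x y. x \<in> B \<and> y \<in> S I}"
  proof (intro set_eqI iffI)
    fix z assume "z \<in> S (insert j I)"
    then show "z \<in> {x + y |x y. x \<in> B \<and> y \<in> S I}"
      using insert.hyps by (auto simp: S_def B_def)
  next
    fix z assume "z \<in> {x + y |x y. x \<in> B \<and> y \<in> S I}"
    then obtain a t where a: "a \<in> A j" and t: "\<forall>i\<in>I. t i \<in> A i" and z: "z = c j * a + (\<Sum>i\<in>I. c i * t i)"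
      by (auto simp: S_def B_def)
    have "(\<Sum>i\<in>I. c i * (t(j := a)) i) = (\<Sum>i\<in>I. c i * t i)"
      using insert.hyps by (intro sum.cong) auto
    then have "z = (\<Sum>i\<in>insert j I. c i * (t(j := a)) i)"
      using z insert.hyps by simp
    moreover have "\<forall>i\<in>insert j I. (t(j := a)) i \<in> A i"
      using a t by auto
    ultimately show "z \<in> S (insert j I)" unfolding S_def by blast
  qed
  have cS: "compact (S (insert j I))"
    unfolding S by (rule compact_sums[OF cB(1) IH(1)])
  obtain p where p: "p \<in> B" "\<And>x. x \<in> B \<Longrightarrow> x \<le> p"
    using compact_attains_sup[OF cB] by blast
  obtain q where q: "q \<in> S I" "\<And>x. x \<in> S I \<Longrightarrow> q \<le> x"
    using compact_attains_inf[OF IH(1,2)] by blast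
  \<comment> \<open>The translates of the two summands by the largest and the smallest element of the other
    one lie in the sumset and meet in a single point.\<close>
  let ?B = "(+) q ` B" and ?S = "(+) p ` S I"
  have sub: "?B \<union> ?S \<subseteq> S (insert j I)"
    unfolding S using p q by (auto; metis add.commute)
  have comp: "compact ?B" "compact ?S"
    using cB IH by (auto intro!: compact_continuous_image continuous_intros)
  have int: "?B \<inter> ?S \<subseteq> {p + q}"
  proof
    fix x assume "x \<in> ?B \<inter> ?S"
    then obtain b y where "b \<in> B" "y \<in> S I" "x = q + b" "x = p + y" by auto
    then have "x \<le> p + q" "p + q \<le> x" using p(2)[of b] q(2)[of y] by auto
    then show "x \<in> {p + q}" by simp
  qed
  have fm: "?B \<in> fmeasurable lborel" "?S \<in> fmeasurable lborel" "S (insert j I) \<in> fmeasurable lborel"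
    using comp cS by (auto intro: fmeasurable_compact)
  have "measure lborel (?B \<inter> ?S) \<le> measure lborel {p + q}"
    by (rule measure_mono_fmeasurable[OF int]) (use fm in \<open>auto intro: fmeasurable_compact\<close>)
  then have i0: "measure lborel (?B \<inter> ?S) = 0"
    by (simp add: measure_nonneg order_antisym)
  have tr: "measure lborel ((+) a ` T) = measure lborel T" if "compact T" for a :: real and T
  proof -
    have "compact ((+) a ` T)"
      using that by (auto intro!: compact_continuous_image continuous_intros)
    then show ?thesis using measure_translation[of a T] that by (simp add: compact_imp_closed)
  qed
  have "measure lborel (?B \<union> ?S) = measure lborel ?B + measure lborel ?S"
    using measure_Un3[OF fm(1,2)] i0 by simp
  then have "measure lborel B + measure lborel (S I) = measure lborel (?B \<union> ?S)"
    using tr cB IH by simp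
  also have "\<dots> \<le> measure lborel (S (insert j I))"
    by (rule measure_mono_fmeasurable[OF sub]) (use comp fm in \<open>auto intro!: sets.Un borel_compact\<close>)
  finally show ?case
    using mB IH cS cB insert.hyps by (auto simp: S)
qed

text \<open>Inner approximation by compact sets. A sumset of Borel sets may fail to be Borel, so the
  bound is stated for a Borel set \<open>B\<close> that contains it.\<close>

lemma sumset_measure_ge:
  fixes A :: "'i \<Rightarrow> real set" and c :: "'i \<Rightarrow> real"
  assumes I: "finite I"
    and A: "\<And>i. i \<in> I \<Longrightarrow> A i \<in> sets borel" "\<And>i. i \<in> I \<Longrightarrow> A i \<noteq> {}" "\<And>i. i \<in> I \<Longrightarrow> bounded (A i)"
    and c: "\<And>i. i \<in> I \<Longrightarrow> c i > 0" "(\<Sum>i\<in>I. c i) = 1"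
    and B: "B \<in> sets borel" "\<And>t. (\<forall>i\<in>I. t i \<in> A i) \<Longrightarrow> (\<Sum>i\<in>I. c i * t i) \<in> B"
  shows "ennreal (\<Sum>i\<in>I. c i * measure lborel (A i)) \<le> emeasure lborel B"
proof (rule ennreal_le_epsilon)
  fix e :: real assume e: "e > 0"
  \<comment> \<open>The closed inner approximation may be empty, so a point of \<open>A i\<close> is
    added to it. Compactness comes from the boundedness of \<open>A i\<close>.\<close>
  have "\<exists>C. compact C \<and> C \<noteq> {} \<and> C \<subseteq> A i \<and> measure lborel (A i) \<le> measure lborel C + e" if i: "i \<in> I" for i
  proof -
    have "A i \<in> sets lebesgue" using A i by auto
    then obtain T where T: "closed T" "T \<subseteq> A i" "A i - T \<in> lmeasurable" "emeasure lebesgue (A i - T) < ennreal e"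
      using sets_lebesgue_inner_closed[OF _ e] by metis
    obtain p where p: "p \<in> A i" using A(2)[OF i] by auto
    have cT: "compact (insert p T)"
      using T A(3)[OF i] by (intro compact_insert) (auto simp: compact_eq_bounded_closed intro: bounded_subset)
    have fA: "A i \<in> fmeasurable lborel"
      using A i emeasure_bounded_finite[OF A(3)[OF i]] by (auto simp: fmeasurable_def)
    have "measure lborel (A i) \<le> measure lborel (insert p T \<union> (A i - T))"
      using A i T by (intro measure_mono_fmeasurable fmeasurable.Un fmeasurable_Diff fA fmeasurable_compact cT) auto
    also have "\<dots> \<le> measure lborel (insert p T) + measure lborel (A i - T)"
      using A i T by (intro measure_Un_le) auto
    also have "measure lborel (A i - T) \<le> e"
    proof -
      have "A i - T \<in> sets borel" using A i T by auto
      then have "emeasure lborel (A i - T) \<le> ennreal e" using T(4) by auto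
      then show ?thesis using e by (simp add: measure_def enn2real_leI)
    qed
    finally show ?thesis using cT p T by (intro exI[of _ "insert p T"]) auto
  qed
  then obtain C where C: "\<And>i. i \<in> I \<Longrightarrow> compact (C i)" "\<And>i. i \<in> I \<Longrightarrow> C i \<noteq> {}" "\<And>i. i \<in> I \<Longrightarrow> C i \<subseteq> A i"
     "\<And>i. i \<in> I \<Longrightarrow> measure lborel (A i) \<le> measure lborel (C i) + e"
    by metis
  let ?S = "{\<Sum>i\<in>I. c i * t i |t. \<forall>i\<in>I. t i \<in> C i}"
  have S: "compact ?S" "(\<Sum>i\<in>I. c i * measure lborel (C i)) \<le> measure lborel ?S"
    using weighted_sumset_compact[OF I, of C c] C c by auto
  have "(\<Sum>i\<in>I. c i * measure lborel (A i)) \<le> (\<Sum>i\<in>I. c i * (measure lborel (C i) + e))"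
    using C(4) c by (intro sum_mono mult_left_mono) (auto intro: less_imp_le)
  \<comment> \<open>The weights sum to 1, so a loss of \<open>e\<close> in each set is a loss of
    \<open>e\<close> overall.\<close>
  also have "\<dots> = (\<Sum>i\<in>I. c i * measure lborel (C i)) + e"
    using c(2) by (simp add: distrib_left sum.distrib flip: sum_distrib_right)
  also have "\<dots> \<le> measure lborel ?S + e" using S by simp
  finally have "ennreal (\<Sum>i\<in>I. c i * measure lborel (A i)) \<le> ennreal (measure lborel ?S) + ennreal e"
    using e by (simp flip: ennreal_plus)
  also have "ennreal (measure lborel ?S) = emeasure lborel ?S"
    using fmeasurable_compact[OF S(1)] by (simp add: emeasure_eq_measure2)
  also have "emeasure lborel ?S \<le> emeasure lborel B"
  proof (rule emeasure_mono)
    show "?S \<subseteq> B"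
    proof
      fix x assume "x \<in> ?S"
      then obtain t where t: "\<forall>i\<in>I. t i \<in> C i" and x: "x = (\<Sum>i\<in>I. c i * t i)" by blast
      have "\<forall>i\<in>I. t i \<in> A i" using t C(3) by blast
      then show "x \<in> B" unfolding x by (rule B(2))
    qed
  qed (simp add: B)
  finally show "ennreal (\<Sum>i\<in>I. c i * measure lborel (A i)) \<le> emeasure lborel B + ennreal e"
    by (simp add: add_right_mono)
qed

text \<open>Levels are measured relative to \<open>S\<close>, with \<open>l\<close> in the unit
  interval, so that functions with different suprema can be compared at the same \<open>l\<close>.
  Truncation at \<open>S\<close> keeps the formula an equality when \<open>f\<close> exceeds
  \<open>S\<close>.\<close>

lemma nn_integral_layer_cake:
  fixes f :: "real \<Rightarrow> real"
  assumes [measurable]: "f \<in> borel_measurable borel" and "S > 0" "\<And>x. f x \<ge> 0"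
  shows "(\<integral>\<^sup>+x. ennreal (min S (f x)) \<partial>lborel) =
    ennreal S * (\<integral>\<^sup>+l. indicator {0<..<1} l * emeasure lborel {x. l * S < f x} \<partial>lborel)"
proof -
  have *: "ennreal (min S (f x)) = ennreal S * (\<integral>\<^sup>+l. indicator {0<..<1} l * indicator {x. l * S < f x} x \<partial>lborel)" for x
  proof -
    have "(\<lambda>l. indicator {0<..<1} l * indicator {x. l * S < f x} x :: ennreal) = indicator {0<..<min 1 (f x / S)}"
      using assms by (auto simp: fun_eq_iff indicator_def field_simps)
    then show ?thesis using assms
      by (simp flip: ennreal_mult add: min_mult_distrib_left)
  qed
  show ?thesis
    unfolding * 
    apply (subst nn_integral_cmult, measurable)
    apply (subst lborel_pair.Fubini', measurable)
    by (intro arg_cong[where f="(*) _"] nn_integral_cong) (simp add: nn_integral_cmult_indicator)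
qed

text \<open>Jensen's inequality for \<open>exp\<close> at the points
  \<open>ln (x i)\<close>.\<close>

lemma weighted_arith_geom_mean:
  fixes x c :: "'i \<Rightarrow> real"
  assumes "finite I" "\<And>i. i \<in> I \<Longrightarrow> c i \<ge> 0" "(\<Sum>i\<in>I. c i) = 1" "\<And>i. i \<in> I \<Longrightarrow> x i > 0"
  shows "(\<Prod>i\<in>I. x i powr c i) \<le> (\<Sum>i\<in>I. c i * x i)"
proof -
  have "(\<Prod>i\<in>I. x i powr c i) = (\<Prod>i\<in>I. exp (c i * ln (x i)))"
    using assms(4) by (intro prod.cong) (force simp: powr_def)+
  also have "\<dots> = exp (\<Sum>i\<in>I. c i *\<^sub>R ln (x i))"
    using assms by (simp add: exp_sum)
  also have "\<dots> \<le> (\<Sum>i\<in>I. c i * exp (ln (x i)))"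
    using assms by (intro convex_on_sum[OF _ _ exp_convex]) auto
  also have "\<dots> = (\<Sum>i\<in>I. c i * x i)"
    using assms(4) by (intro sum.cong) auto
  finally show ?thesis .
qed

text \<open>When every \<open>f i\<close> is measured against its own supremum, all superlevel sets
  of relative height below 1 are nonempty and the sumset bound applies to them. Integration over the
  height bounds a weighted arithmetic mean of the normalised integrals, which dominates their
  geometric mean.\<close>

lemma prekopa_leindler_real:
  fixes f :: "'i \<Rightarrow> real \<Rightarrow> real" and h :: "real \<Rightarrow> real"
  assumes I: "finite I" and c: "\<And>i. i \<in> I \<Longrightarrow> c i > 0" "(\<Sum>i\<in>I. c i) = 1"
    and fm: "\<And>i. i \<in> I \<Longrightarrow> f i \<in> borel_measurable borel"
    and f0: "\<And>i t. i \<in> I \<Longrightarrow> 0 \<le> f i t" and fM: "\<And>i t. i \<in> I \<Longrightarrow> f i t \<le> M i"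
    and fR: "\<And>i t. i \<in> I \<Longrightarrow> f i t \<noteq> 0 \<Longrightarrow> \<bar>t\<bar> \<le> R i"
    and h: "integrable lborel h" "\<And>t. 0 \<le> h t"
    and fh: "\<And>t. (\<Prod>i\<in>I. f i (t i) powr c i) \<le> h (\<Sum>i\<in>I. c i * t i)"
  shows "(\<Prod>i\<in>I. (\<integral>t. f i t \<partial>lborel) powr c i) \<le> (\<integral>t. h t \<partial>lborel)"
proof (cases "\<exists>i\<in>I. (\<integral>t. f i t \<partial>lborel) = 0")
  \<comment> \<open>A factor \<open>0 powr c i\<close> is 0, and the normalisation in the other case
    needs positive suprema.\<close>
  case True
  then have "(\<Prod>i\<in>I. (\<integral>t. f i t \<partial>lborel) powr c i) = 0"
    using I by (auto simp: prod_zero_iff)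
  then show ?thesis using h by simp
next
  case False
  have hm[measurable]: "h \<in> borel_measurable borel" using h(1) by auto
  have fint: "integrable lborel (f i)" if i: "i \<in> I" for i
  proof (rule Bochner_Integration.integrable_bound[of _ "\<lambda>t. M i * indicator {-R i..R i} t"])
    show "integrable lborel (\<lambda>t. M i * indicator {-R i..R i} t)"
      by (intro integrable_mult_right integrable_real_indicator emeasure_bounded_finite) auto
    show "f i \<in> borel_measurable lborel" using fm[OF i] by simp
    have "norm (f i t) \<le> norm (M i * indicator {-R i..R i} t)" for t
      using f0[OF i, of t] fM[OF i, of t] fR[OF i, of t] by (cases "f i t = 0") (auto simp: indicator_def abs_le_iff)
    then show "AE t in lborel. norm (f i t) \<le> norm (M i * indicator {-R i..R i} t)" by simp
  qed
  have fpos: "(\<integral>t. f i t \<partial>lborel) > 0" if "i \<in> I" for i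
    using False that f0 by (metis Bochner_Integration.integral_nonneg order_le_less)
  define S where "S i = (SUP t. f i t)" for i
  have bdd: "bdd_above (range (f i))" if "i \<in> I" for i using fM[OF that] by (auto simp: bdd_above_def)
  have fS: "f i t \<le> S i" if "i \<in> I" for i t
    unfolding S_def by (rule cSUP_upper[OF _ bdd[OF that]]) simp
  have Spos: "S i > 0" if i: "i \<in> I" for i
  proof (rule ccontr)
    assume "\<not> S i > 0"
    then have "f i t = 0" for t using fS[OF i, of t] f0[OF i, of t] by linarith
    then show False using fpos[OF i] by simp
  qed
  \<comment> \<open>The weights sum to 1, so the weighted geometric mean of the levels
    \<open>l * S i\<close> is \<open>l * C\<close>; this is the level of \<open>h\<close> to compare
    with.\<close>
  define C where "C = (\<Prod>i\<in>I. S i powr c i)"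
  have Cpos: "C > 0" unfolding C_def by (intro prod_pos) (force dest: Spos)
  define X where "X f S = (\<integral>\<^sup>+l. indicator {0<..<1} l * emeasure lborel {x::real. l * S < f x} \<partial>lborel)" for f and S :: real
  have level: "(\<Sum>i\<in>I. ennreal (c i) * emeasure lborel {x. l * S i < f i x}) \<le> emeasure lborel {x. l * C < h x}"
    if l: "l \<in> {0<..<1}" for l
  proof -
    let ?A = "\<lambda>i. {x. l * S i < f i x}"
    have Am: "?A i \<in> sets borel" if "i \<in> I" for i using fm[OF that] by measurable
    have Ab: "bounded (?A i)" if i: "i \<in> I" for i
    proof (rule bounded_subset[OF bounded_closed_interval[of "-R i" "R i"]])
      have "0 < l * S i" using l Spos[OF i] by auto
      then have "\<bar>x\<bar> \<le> R i" if "x \<in> ?A i" for x using that by (intro fR[OF i]) auto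
      then show "?A i \<subseteq> {-R i..R i}" by (auto simp: abs_le_iff minus_le_iff)
    qed
    \<comment> \<open>Here the least upper bound matters: a larger normalisation could leave level
      sets empty, and the sumset bound fails for empty sets.\<close>
    have Ane: "?A i \<noteq> {}" if i: "i \<in> I" for i
    proof -
      have "l * S i < S i" using l Spos[OF i] by auto
      then obtain t where "l * S i < f i t"
        unfolding S_def using less_cSUP_iff[OF _ bdd[OF i]] by auto
      then show ?thesis by auto
    qed
    have "ennreal (\<Sum>i\<in>I. c i * measure lborel (?A i)) \<le> emeasure lborel {x. l * C < h x}"
    proof (rule sumset_measure_ge[OF I Am Ane Ab c])
      fix t assume t: "\<forall>i\<in>I. t i \<in> ?A i"
      obtain i0 where i0: "i0 \<in> I" using c(2) by fastforce
      have st: "0 < (l * S i) powr c i \<and> (l * S i) powr c i < f i (t i) powr c i" if i: "i \<in> I" for i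
      proof -
        have "0 < l * S i" "l * S i < f i (t i)" using l Spos[OF i] t i by auto
        then show ?thesis using c(1)[OF i] by (auto simp: powr_less_mono2)
      qed
      have "l * C = (\<Prod>i\<in>I. (l * S i) powr c i)"
      proof -
        have "(\<Prod>i\<in>I. l powr c i) = l powr (\<Sum>i\<in>I. c i)"
          using l I by (subst powr_sum) auto
        then have "(\<Prod>i\<in>I. l powr c i) = l" using c l by simp
        moreover have "(\<Prod>i\<in>I. (l * S i) powr c i) = (\<Prod>i\<in>I. l powr c i) * C"
          unfolding C_def prod.distrib[symmetric]
          using l Spos by (intro prod.cong) (auto simp: powr_mult less_imp_le)
        ultimately show ?thesis by simp
      qed
      also have "\<dots> < (\<Prod>i\<in>I. f i (t i) powr c i)"
        using st i0 by (intro prod_mono_strict[of i0] I) (auto simp: less_imp_le, force+)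
      also have "\<dots> \<le> h (\<Sum>i\<in>I. c i * t i)" by (rule fh)
      finally show "(\<Sum>i\<in>I. c i * t i) \<in> {x. l * C < h x}" by simp
    qed auto
    moreover have "ennreal (c i) * emeasure lborel (?A i) = ennreal (c i * measure lborel (?A i))" if i: "i \<in> I" for i
    proof -
      have "emeasure lborel (?A i) = ennreal (measure lborel (?A i))"
        using emeasure_bounded_finite[OF Ab[OF i]] by (intro emeasure_eq_ennreal_measure) auto
      then show ?thesis using c(1)[OF i] by (simp add: ennreal_mult)
    qed
    ultimately show ?thesis using c by (simp add: sum_ennreal less_imp_le)
  qed
  have Xf: "X (f i) (S i) = ennreal ((\<integral>t. f i t \<partial>lborel) / S i)" if i: "i \<in> I" for i
  proof -
    have "ennreal (\<integral>t. f i t \<partial>lborel) = (\<integral>\<^sup>+t. ennreal (f i t) \<partial>lborel)"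
      using fint[OF i] f0[OF i] by (subst nn_integral_eq_integral) auto
    also have "\<dots> = (\<integral>\<^sup>+t. ennreal (min (S i) (f i t)) \<partial>lborel)"
      using fS[OF i] by (simp add: min.absorb2)
    also have "\<dots> = ennreal (S i) * X (f i) (S i)"
      unfolding X_def using fm f0 i Spos by (intro nn_integral_layer_cake) auto
    finally have e: "ennreal (\<integral>t. f i t \<partial>lborel) = ennreal (S i) * X (f i) (S i)" .
    have "X (f i) (S i) = ennreal (1 / S i) * (ennreal (S i) * X (f i) (S i))"
      using Spos[OF i] by (simp add: mult.assoc[symmetric] flip: ennreal_mult)
    also have "\<dots> = ennreal ((\<integral>t. f i t \<partial>lborel) / S i)"
      unfolding e[symmetric] using Spos[OF i] fpos[OF i] by (simp flip: ennreal_mult)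
    finally show ?thesis .
  qed
  \<comment> \<open>\<open>h\<close> may exceed \<open>C\<close>, so the truncation in the
    layer-cake formula gives only an upper bound here, while it is vacuous for each
    \<open>f i\<close>.\<close>
  have Xh: "X h C \<le> ennreal ((\<integral>t. h t \<partial>lborel) / C)"
  proof -
    have "X h C = ennreal (1 / C) * (ennreal C * X h C)"
      using Cpos by (simp add: mult.assoc[symmetric] flip: ennreal_mult)
    also have "ennreal C * X h C = (\<integral>\<^sup>+t. ennreal (min C (h t)) \<partial>lborel)"
      unfolding X_def using h Cpos by (intro nn_integral_layer_cake[symmetric]) auto
    also have "\<dots> \<le> (\<integral>\<^sup>+t. ennreal (h t) \<partial>lborel)"
      by (intro nn_integral_mono ennreal_leI) auto
    also have "\<dots> = ennreal (\<integral>t. h t \<partial>lborel)"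
      using h by (subst nn_integral_eq_integral) auto
    finally show ?thesis using Cpos h by (simp add: mult_left_mono flip: ennreal_mult)
  qed
  have "(\<Sum>i\<in>I. ennreal (c i) * X (f i) (S i)) =
      (\<integral>\<^sup>+l. (\<Sum>i\<in>I. ennreal (c i) * (indicator {0<..<1} l * emeasure lborel {x. l * S i < f i x})) \<partial>lborel)"
  proof -
    have [measurable]: "(\<lambda>l. emeasure lborel {x. l * S i < f i x}) \<in> borel_measurable lborel" if "i \<in> I" for i
    proof -
      have [measurable]: "f i \<in> borel_measurable borel" using fm that by auto
      show ?thesis by measurable
    qed
    show ?thesis unfolding X_def
      by (subst nn_integral_sum) (auto simp: nn_integral_cmult)
  qed
  also have "\<dots> \<le> X h C"
    unfolding X_def
  proof (intro nn_integral_mono)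
    fix l :: real
    show "(\<Sum>i\<in>I. ennreal (c i) * (indicator {0<..<1} l * emeasure lborel {x. l * S i < f i x}))
      \<le> indicator {0<..<1} l * emeasure lborel {x. l * C < h x}"
      using level[of l] by (cases "l \<in> {0<..<1}") auto
  qed
  also note Xh
  also have "(\<Sum>i\<in>I. ennreal (c i) * X (f i) (S i)) = ennreal (\<Sum>i\<in>I. c i * ((\<integral>t. f i t \<partial>lborel) / S i))"
  proof -
    have "ennreal (c i) * X (f i) (S i) = ennreal (c i * ((\<integral>t. f i t \<partial>lborel) / S i))" if i: "i \<in> I" for i
      using c(1)[OF i] fpos[OF i] Spos[OF i] by (simp add: Xf[OF i] ennreal_mult' less_imp_le flip: ennreal_mult)
    moreover have "0 \<le> c i * ((\<integral>t. f i t \<partial>lborel) / S i)" if i: "i \<in> I" for i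
      using c(1)[OF i] fpos[OF i] Spos[OF i] by simp
    ultimately show ?thesis by (subst sum_ennreal[symmetric]) auto
  qed
  finally have "ennreal (\<Sum>i\<in>I. c i * ((\<integral>t. f i t \<partial>lborel) / S i)) \<le> ennreal ((\<integral>t. h t \<partial>lborel) / C)" .
  then have le: "(\<Sum>i\<in>I. c i * ((\<integral>t. f i t \<partial>lborel) / S i)) \<le> (\<integral>t. h t \<partial>lborel) / C"
    using Cpos h by (subst (asm) ennreal_le_iff) auto
  \<comment> \<open>The arithmetic mean of the normalised integrals bounds their geometric mean, and
    the factor \<open>C\<close> restores the suprema.\<close>
  have "(\<Prod>i\<in>I. (\<integral>t. f i t \<partial>lborel) powr c i) = (\<Prod>i\<in>I. ((\<integral>t. f i t \<partial>lborel) / S i) powr c i) * C"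
    unfolding C_def prod.distrib[symmetric]
  proof (intro prod.cong refl)
    fix i assume i: "i \<in> I"
    show "(\<integral>t. f i t \<partial>lborel) powr c i = ((\<integral>t. f i t \<partial>lborel) / S i) powr c i * S i powr c i"
      using Spos[OF i] fpos[OF i] by (simp add: powr_divide)
  qed
  also have "\<dots> \<le> (\<Sum>i\<in>I. c i * ((\<integral>t. f i t \<partial>lborel) / S i)) * C"
    using Cpos c fpos Spos I by (intro mult_right_mono weighted_arith_geom_mean) (auto simp: less_imp_le)
  also have "\<dots> \<le> (\<integral>t. h t \<partial>lborel) / C * C"
    using Cpos le by (intro mult_right_mono) auto
  finally show ?thesis using Cpos by simp
qed

section \<open>Reverse Brascamp--Lieb inequality for coordinate subspaces\<close>

interpretation lebJ: product_sigma_finite "\<lambda>_::nat. lborel :: real measure"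
  by standard

text \<open>A class in which all integrals are finite and which is stable under integrating out
  coordinates and under affine substitution. The conditions are imposed only on extensional
  functions, which are the points of the product space.\<close>

definition tame :: "nat set \<Rightarrow> ((nat \<Rightarrow> real) \<Rightarrow> real) \<Rightarrow> bool" where
  "tame J f \<longleftrightarrow> f \<in> borel_measurable (lebJ J) \<and>
    (\<exists>M R. \<forall>x \<in> PiE J (\<lambda>_. UNIV). 0 \<le> f x \<and> f x \<le> M \<and> (f x \<noteq> 0 \<longrightarrow> (\<forall>j\<in>J. \<bar>x j\<bar> \<le> R)))"

lemma tameE:
  assumes "tame J f"
  obtains M R where "f \<in> borel_measurable (lebJ J)" "M \<ge> 0" "R \<ge> 0"
    "\<And>x. x \<in> PiE J (\<lambda>_. UNIV) \<Longrightarrow> 0 \<le> f x" "\<And>x. x \<in> PiE J (\<lambda>_. UNIV) \<Longrightarrow> f x \<le> M"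
    "\<And>x j. x \<in> PiE J (\<lambda>_. UNIV) \<Longrightarrow> f x \<noteq> 0 \<Longrightarrow> j \<in> J \<Longrightarrow> \<bar>x j\<bar> \<le> R"
proof -
  obtain M R where MR: "\<forall>x \<in> PiE J (\<lambda>_. UNIV). 0 \<le> f x \<and> f x \<le> M \<and> (f x \<noteq> 0 \<longrightarrow> (\<forall>j\<in>J. \<bar>x j\<bar> \<le> R))"
    and "f \<in> borel_measurable (lebJ J)"
    using assms unfolding tame_def by auto
  show thesis
    by (rule that[of "max M 0" "max R 0"]) (use MR in \<open>auto simp: le_max_iff_disj tame_def[THEN iffD1, OF assms]\<close>)
qed

lemma tame_nonneg: "tame J f \<Longrightarrow> x \<in> PiE J (\<lambda>_. UNIV) \<Longrightarrow> 0 \<le> f x"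
  unfolding tame_def by blast

lemma tameI:
  assumes "f \<in> borel_measurable (lebJ J)"
    "\<And>x. x \<in> PiE J (\<lambda>_. UNIV) \<Longrightarrow> 0 \<le> f x" "\<And>x. x \<in> PiE J (\<lambda>_. UNIV) \<Longrightarrow> f x \<le> M"
    "\<And>x j. x \<in> PiE J (\<lambda>_. UNIV) \<Longrightarrow> f x \<noteq> 0 \<Longrightarrow> j \<in> J \<Longrightarrow> \<bar>x j\<bar> \<le> R"
  shows "tame J f"
  using assms unfolding tame_def by blast

lemma space_lebJ: "space (lebJ J) = PiE J (\<lambda>_. UNIV)"
  by (simp add: space_PiM)


lemma box_fmeasurable:
  assumes "finite J"
  shows "PiE J (\<lambda>j. {a j..b j::real}) \<in> fmeasurable (lebJ J)"
proof (rule fmeasurableI)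
  show "PiE J (\<lambda>j. {a j..b j}) \<in> sets (lebJ J)"
    using assms by (intro sets_PiM_I_finite) auto
  have "emeasure (lebJ J) (PiE J (\<lambda>j. {a j..b j})) = (\<Prod>j\<in>J. emeasure lborel {a j..b j})"
    using assms by (intro lebJ.emeasure_PiM) auto
  also have "\<dots> < \<infinity>"
    using emeasure_bounded_finite[OF bounded_closed_interval[where 'a=real]]
    by (simp add: less_top[symmetric] ennreal_prod_eq_top)
  finally show "emeasure (lebJ J) (PiE J (\<lambda>j. {a j..b j})) < \<infinity>" .
qed

lemma box_measure:
  assumes "finite J" "\<And>j. j \<in> J \<Longrightarrow> a j \<le> b j"
  shows "measure (lebJ J) (PiE J (\<lambda>j. {a j..b j::real})) = (\<Prod>j\<in>J. b j - a j)"
proof -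
  have "emeasure (lebJ J) (PiE J (\<lambda>j. {a j..b j})) = (\<Prod>j\<in>J. emeasure lborel {a j..b j})"
    using assms by (intro lebJ.emeasure_PiM) auto
  also have "\<dots> = (\<Prod>j\<in>J. ennreal (b j - a j))"
    using assms by (intro prod.cong) auto
  also have "\<dots> = ennreal (\<Prod>j\<in>J. b j - a j)"
    using assms by (intro prod_ennreal) auto
  finally show ?thesis
    using assms by (simp add: measure_def prod_nonneg)
qed

lemma tame_integrable:
  assumes "finite J" "tame J f"
  shows "integrable (lebJ J) f"
proof -
  obtain M R where f: "f \<in> borel_measurable (lebJ J)" "M \<ge> 0" "R \<ge> 0"
    "\<And>x. x \<in> PiE J (\<lambda>_. UNIV) \<Longrightarrow> 0 \<le> f x" "\<And>x. x \<in> PiE J (\<lambda>_. UNIV) \<Longrightarrow> f x \<le> M"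
    "\<And>x j. x \<in> PiE J (\<lambda>_. UNIV) \<Longrightarrow> f x \<noteq> 0 \<Longrightarrow> j \<in> J \<Longrightarrow> \<bar>x j\<bar> \<le> R"
    using tameE[OF assms(2)] by metis
  let ?B = "PiE J (\<lambda>j. {-R..R})"
  show ?thesis
  proof (rule Bochner_Integration.integrable_bound[of _ "\<lambda>x. M * indicator ?B x"])
    show "integrable (lebJ J) (\<lambda>x. M * indicator ?B x)"
      using box_fmeasurable[OF assms(1), of "\<lambda>_. -R" "\<lambda>_. R"]
      by (intro integrable_mult_right integrable_real_indicator) (auto simp: fmeasurable_def)
    show "AE x in lebJ J. norm (f x) \<le> norm (M * indicator ?B x)"
    proof (rule AE_I2)
      fix x assume "x \<in> space (lebJ J)"
      then have x: "x \<in> PiE J (\<lambda>_. UNIV)" by (simp add: space_lebJ)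
      show "norm (f x) \<le> norm (M * indicator ?B x)"
      proof (cases "f x = 0")
        case False
        then have "x \<in> ?B" using f(6)[OF x] x by (auto simp: PiE_iff abs_le_iff minus_le_iff)
        then show ?thesis using f(4,5)[OF x] by simp
      qed simp
    qed
  qed (use f in auto)
qed

lemma fun_upd_PiE: "x \<in> PiE J (\<lambda>_. UNIV) \<Longrightarrow> x(j := t) \<in> PiE (insert j J) (\<lambda>_. UNIV)"
  by (auto simp: PiE_iff extensional_def)

lemma slice_measurable:
  assumes "j \<notin> J" "f \<in> borel_measurable (lebJ (insert j J))" "x \<in> PiE J (\<lambda>_. UNIV)"
  shows "(\<lambda>t. f (x(j := t))) \<in> borel_measurable borel"
proof -
  have "(\<lambda>t. x(j := t)) \<in> measurable lborel (lebJ (insert j J))"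
    using measurable_component_update[of x J "\<lambda>_. lborel" j] assms by (simp add: space_lebJ)
  from measurable_compose[OF this assms(2)] show ?thesis by simp
qed

text \<open>Keeps the partially integrated functions in the class during the induction over
  coordinates. The new bound is \<open>M\<close> times the length of \<open>{-R..R}\<close>.\<close>

lemma tame_slice:
  assumes J: "finite J" "j \<notin> J" and f: "tame (insert j J) f"
  shows "tame J (\<lambda>x. \<integral>t. f (x(j := t)) \<partial>lborel)"
proof -
  obtain M R where f: "f \<in> borel_measurable (lebJ (insert j J))" "M \<ge> 0" "R \<ge> 0"
    "\<And>x. x \<in> PiE (insert j J) (\<lambda>_. UNIV) \<Longrightarrow> 0 \<le> f x" "\<And>x. x \<in> PiE (insert j J) (\<lambda>_. UNIV) \<Longrightarrow> f x \<le> M"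
    "\<And>x k. x \<in> PiE (insert j J) (\<lambda>_. UNIV) \<Longrightarrow> f x \<noteq> 0 \<Longrightarrow> k \<in> insert j J \<Longrightarrow> \<bar>x k\<bar> \<le> R"
    using tameE[OF f] by metis
  show ?thesis
  proof (rule tameI[where M="M * (2 * R)" and R=R])
    have "(\<lambda>(x, t). f (x(j := t))) \<in> borel_measurable (lebJ J \<Otimes>\<^sub>M lborel)"
      using measurable_compose[OF measurable_add_dim f(1)] by (simp add: case_prod_beta')
    then show "(\<lambda>x. \<integral>t. f (x(j := t)) \<partial>lborel) \<in> borel_measurable (lebJ J)"
      by (intro lborel.borel_measurable_lebesgue_integral) (simp add: case_prod_beta')
  next
    fix x :: "nat \<Rightarrow> real" assume x: "x \<in> PiE J (\<lambda>_. UNIV)"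
    note xt = fun_upd_PiE[OF x, of j]
    show "0 \<le> (\<integral>t. f (x(j := t)) \<partial>lborel)" using f(4)[OF xt] by simp
    have "f (x(j := t)) \<le> M * indicator {-R..R} t" for t
      using f(5)[OF xt, of t] f(6)[OF xt, of t j] by (cases "f (x(j := t)) = 0") (auto simp: indicator_def f(2) abs_le_iff)
    then have "(\<integral>t. f (x(j := t)) \<partial>lborel) \<le> (\<integral>t. M * indicator {-R..R} t \<partial>lborel)"
      using f(4)[OF xt] by (intro integral_mono_AE') 
        (auto intro!: integrable_mult_right integrable_real_indicator emeasure_bounded_finite mult_nonneg_nonneg f(2))
    also have "\<dots> = M * (2 * R)" using f(3) by simp
    finally show "(\<integral>t. f (x(j := t)) \<partial>lborel) \<le> M * (2 * R)" .
    fix k assume nz: "(\<integral>t. f (x(j := t)) \<partial>lborel) \<noteq> 0" and k: "k \<in> J"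
    have "\<exists>t. f (x(j := t)) \<noteq> 0" using nz by (auto intro: ccontr)
    then obtain t where "f (x(j := t)) \<noteq> 0" by blast
    from f(6)[OF xt this, of k] show "\<bar>x k\<bar> \<le> R" using k J by (auto split: if_splits)
  qed
qed

text \<open>Barthe's inequality for coordinate subspaces. One coordinate \<open>j\<close> is
  integrated at a time: only the factors with \<open>j \<in> \<tau> i\<close> depend on it and their
  weights sum to 1, so the one-dimensional Prekopa-Leindler inequality applies with the other
  coordinates frozen. The integrated functions then satisfy the hypotheses for the smaller
  coordinate set.\<close>

lemma coordinate_reverse_brascamp_lieb:
  fixes f :: "'i \<Rightarrow> (nat \<Rightarrow> real) \<Rightarrow> real" and c :: "'i \<Rightarrow> real"
  assumes "finite J" "finite I" "\<And>i. i \<in> I \<Longrightarrow> c i > 0"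
    "\<And>i. i \<in> I \<Longrightarrow> \<tau> i \<subseteq> J"
    "\<And>j. j \<in> J \<Longrightarrow> (\<Sum>i\<in>{i\<in>I. j \<in> \<tau> i}. c i) = 1"
    "\<And>i. i \<in> I \<Longrightarrow> tame (\<tau> i) (f i)" "tame J h"
    "\<And>x. (\<And>i. i \<in> I \<Longrightarrow> x i \<in> PiE (\<tau> i) (\<lambda>_. UNIV)) \<Longrightarrow>
      (\<Prod>i\<in>I. f i (x i) powr c i) \<le> h (\<lambda>j\<in>J. \<Sum>i\<in>{i\<in>I. j \<in> \<tau> i}. c i * x i j)"
  shows "(\<Prod>i\<in>I. (\<integral>x. f i x \<partial>lebJ (\<tau> i)) powr c i) \<le> (\<integral>x. h x \<partial>lebJ J)"
  using assms(1,4-8)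
proof (induction J arbitrary: \<tau> f h rule: finite_induct)
  case empty
  have \<tau>: "\<tau> i = {}" if "i \<in> I" for i using empty(1)[OF that] by simp
  \<comment> \<open>The product over no coordinates has a single point, so integration is evaluation
    there.\<close>
  have int: "(\<integral>x. g x \<partial>lebJ {}) = g (\<lambda>_. undefined)" for g :: "(nat \<Rightarrow> real) \<Rightarrow> real"
    by (simp add: PiM_empty lebesgue_integral_count_space_finite)
  have "(\<Prod>i\<in>I. f i (\<lambda>_. undefined) powr c i) \<le> h (\<lambda>_. undefined)"
    using empty(5)[of "\<lambda>_ _. undefined"] \<tau> by (simp add: restrict_def)
  then show ?case using \<tau> int by simp
next
  case (insert j J)
  define I1 where "I1 = {i\<in>I. j \<in> \<tau> i}"
  have I1: "finite I1" "I1 \<subseteq> I" using \<open>finite I\<close> by (auto simp: I1_def)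
  define \<tau>' where "\<tau>' i = \<tau> i - {j}" for i
  define f' where "f' i = (if i \<in> I1 then (\<lambda>x. \<integral>t. f i (x(j := t)) \<partial>lborel) else f i)" for i
  define h' where "h' = (\<lambda>x. \<integral>t. h (x(j := t)) \<partial>lborel)"
  have fin: "finite (\<tau>' i)" if "i \<in> I" for i
    using insert.prems(1)[OF that] insert.hyps unfolding \<tau>'_def by (meson finite.insertI finite_Diff finite_subset)
  have \<tau>1: "\<tau> i = insert j (\<tau>' i)" "j \<notin> \<tau>' i" if "i \<in> I1" for i
    using that by (auto simp: I1_def \<tau>'_def)
  have \<tau>2: "\<tau> i = \<tau>' i" if "i \<in> I - I1" for i
    using that by (auto simp: I1_def \<tau>'_def)
  have sets_eq: "{i\<in>I. k \<in> \<tau>' i} = {i\<in>I. k \<in> \<tau> i}" if "k \<in> J" for k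
    using that insert.hyps by (auto simp: \<tau>'_def)
  have IH: "(\<Prod>i\<in>I. (\<integral>x. f' i x \<partial>lebJ (\<tau>' i)) powr c i) \<le> (\<integral>x. h' x \<partial>lebJ J)"
  proof (rule insert.IH)
    fix i assume i: "i \<in> I"
    show "\<tau>' i \<subseteq> J" using insert.prems(1)[OF i] by (auto simp: \<tau>'_def)
    show "tame (\<tau>' i) (f' i)"
      using insert.prems(3)[OF i] \<tau>1[of i] \<tau>2[of i] fin[OF i] i
      by (cases "i \<in> I1") (auto simp: f'_def intro!: tame_slice)
  next
    fix k assume "k \<in> J"
    then show "(\<Sum>i\<in>{i\<in>I. k \<in> \<tau>' i}. c i) = 1" using insert.prems(2)[of k] by (simp add: sets_eq)
  next
    show "tame J h'" unfolding h'_def by (rule tame_slice[OF insert.hyps insert.prems(4)])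
  next
    fix x :: "'i \<Rightarrow> nat \<Rightarrow> real"
    assume x: "\<And>i. i \<in> I \<Longrightarrow> x i \<in> PiE (\<tau>' i) (\<lambda>_. UNIV)"
    define X where "X = (\<lambda>k\<in>J. \<Sum>i\<in>{i\<in>I. k \<in> \<tau>' i}. c i * x i k)"
    have X: "X \<in> PiE J (\<lambda>_. UNIV)" by (auto simp: X_def)
    \<comment> \<open>The factors that do not involve coordinate \<open>j\<close> are constants for
      the one-dimensional inequality. They are moved to the right-hand side as a divisor, so
      \<open>P = 0\<close> is treated apart.\<close>
    define P where "P = (\<Prod>i\<in>I-I1. f i (x i) powr c i)"
    have P0: "P \<ge> 0" unfolding P_def by (intro prod_nonneg) auto
    have split: "(\<Prod>i\<in>I. g i) = (\<Prod>i\<in>I1. g i) * (\<Prod>i\<in>I-I1. g i)" for g :: "'i \<Rightarrow> real"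
      using prod.subset_diff[OF I1(2) \<open>finite I\<close>, of g] by (simp add: mult.commute)
    have "(\<Prod>i\<in>I. f' i (x i) powr c i) = (\<Prod>i\<in>I1. (\<integral>t. f i ((x i)(j := t)) \<partial>lborel) powr c i) * P"
      unfolding split P_def by (simp add: f'_def)
    also have "\<dots> \<le> h' X"
    proof (cases "P = 0")
      case True
      have "tame J h'" unfolding h'_def by (rule tame_slice[OF insert.hyps insert.prems(4)])
      then show ?thesis using True tame_nonneg[OF _ X] by simp
    next
      case False
      with P0 have P: "P > 0" by simp
      have key: "(\<Prod>i\<in>I1. f i ((x i)(j := t i)) powr c i) \<le> h (X(j := \<Sum>i\<in>I1. c i * t i)) / P" for t
      proof -
        define y where "y i = (if i \<in> I1 then (x i)(j := t i) else x i)" for i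
        have y: "y i \<in> PiE (\<tau> i) (\<lambda>_. UNIV)" if "i \<in> I" for i
          using fun_upd_PiE[OF x[OF that], of j "t i"] x[OF that] \<tau>1[of i] \<tau>2[of i] that
          by (auto simp: y_def)
        have eq: "(\<lambda>k\<in>insert j J. \<Sum>i\<in>{i\<in>I. k \<in> \<tau> i}. c i * y i k) = X(j := \<Sum>i\<in>I1. c i * t i)"
        proof
          fix k
          show "(\<lambda>k\<in>insert j J. \<Sum>i\<in>{i\<in>I. k \<in> \<tau> i}. c i * y i k) k = (X(j := \<Sum>i\<in>I1. c i * t i)) k"
          proof (cases "k = j")
            case True
            then show ?thesis by (auto simp: y_def I1_def intro!: sum.cong)
          next
            case False
            then show ?thesis using sets_eq[of k]
              by (auto simp: X_def y_def intro!: sum.cong)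
          qed
        qed
        have "(\<Prod>i\<in>I. f i (y i) powr c i) \<le> h (X(j := \<Sum>i\<in>I1. c i * t i))"
          using insert.prems(5)[of y, OF y] unfolding eq .
        moreover have "(\<Prod>i\<in>I. f i (y i) powr c i) = (\<Prod>i\<in>I1. f i ((x i)(j := t i)) powr c i) * P"
          unfolding split P_def by (simp add: y_def)
        ultimately show ?thesis using P by (simp add: field_simps)
      qed
      have "\<exists>M R. (\<forall>t. 0 \<le> f i ((x i)(j := t)) \<and> f i ((x i)(j := t)) \<le> M \<and> (f i ((x i)(j := t)) \<noteq> 0 \<longrightarrow> \<bar>t\<bar> \<le> R))" 
        if i: "i \<in> I1" for i
      proof -
        have xi: "(x i)(j := t) \<in> PiE (\<tau> i) (\<lambda>_. UNIV)" for t
          using fun_upd_PiE[OF x, of i j t] i I1 \<tau>1(1)[OF i] by auto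
        obtain M R where MR: "\<forall>x \<in> PiE (\<tau> i) (\<lambda>_. UNIV). 0 \<le> f i x \<and> f i x \<le> M \<and> (f i x \<noteq> 0 \<longrightarrow> (\<forall>j\<in>\<tau> i. \<bar>x j\<bar> \<le> R))"
          using insert.prems(3)[of i] i I1 unfolding tame_def by auto
        have "\<bar>t\<bar> \<le> R" if "f i ((x i)(j := t)) \<noteq> 0" for t
        proof -
          have "j \<in> \<tau> i" using i by (simp add: I1_def)
          then have "\<bar>((x i)(j := t)) j\<bar> \<le> R" using bspec[OF MR xi[of t]] that by blast
          then show ?thesis by simp
        qed
        then show ?thesis using bspec[OF MR xi] by blast
      qed
      then obtain M R where MR: "\<And>i t. i \<in> I1 \<Longrightarrow> 0 \<le> f i ((x i)(j := t)) \<and> f i ((x i)(j := t)) \<le> M i \<and> (f i ((x i)(j := t)) \<noteq> 0 \<longrightarrow> \<bar>t\<bar> \<le> R i)"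
        by metis
      have "(\<Prod>i\<in>I1. (\<integral>t. f i ((x i)(j := t)) \<partial>lborel) powr c i) \<le> (\<integral>t. h (X(j := t)) / P \<partial>lborel)"
      proof (rule prekopa_leindler_real[where M=M and R=R])
        show "(\<Sum>i\<in>I1. c i) = 1" using insert.prems(2)[of j] by (simp add: I1_def)
        show "(\<lambda>t. f i ((x i)(j := t))) \<in> borel_measurable borel" if "i \<in> I1" for i
        proof -
          have "i \<in> I" using that I1 by auto
          from insert.prems(3)[OF this] x[OF this] \<tau>1[OF that] show ?thesis
            by (intro slice_measurable[of j "\<tau>' i"]) (simp_all add: tame_def)
        qed
        obtain Mh Rh where h: "h \<in> borel_measurable (lebJ (insert j J))" 
          "\<And>x. x \<in> PiE (insert j J) (\<lambda>_. UNIV) \<Longrightarrow> 0 \<le> h x" "\<And>x. x \<in> PiE (insert j J) (\<lambda>_. UNIV) \<Longrightarrow> h x \<le> Mh"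
          "\<And>x k. x \<in> PiE (insert j J) (\<lambda>_. UNIV) \<Longrightarrow> h x \<noteq> 0 \<Longrightarrow> k \<in> insert j J \<Longrightarrow> \<bar>x k\<bar> \<le> Rh"
          using tameE[OF insert.prems(4)] by metis
        note Xt = fun_upd_PiE[OF X, of j]
        show "0 \<le> h (X(j := t)) / P" for t using h(2)[OF Xt] P by simp
        have "integrable lborel (\<lambda>t. h (X(j := t)))"
        proof (rule Bochner_Integration.integrable_bound[of _ "\<lambda>t. Mh * indicator {-Rh..Rh} t"])
          show "(\<lambda>t. h (X(j := t))) \<in> borel_measurable lborel"
            using slice_measurable[OF insert.hyps(2) h(1) X] by simp
          have "norm (h (X(j := t))) \<le> norm (Mh * indicator {-Rh..Rh} t)" for t
            using h(2,3)[OF Xt, of t] h(4)[OF Xt, of t j]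
            by (cases "h (X(j := t)) = 0") (auto simp: abs_le_iff)
          then show "AE t in lborel. norm (h (X(j := t))) \<le> norm (Mh * indicator {-Rh..Rh} t)" by simp
        qed (intro integrable_mult_right integrable_real_indicator emeasure_bounded_finite, auto)
        then show "integrable lborel (\<lambda>t. h (X(j := t)) / P)" by simp
      qed (use MR I1 assms(3) key in auto)
      then show ?thesis using P by (simp add: h'_def field_simps)
    qed
    finally show "(\<Prod>i\<in>I. f' i (x i) powr c i) \<le> h' (\<lambda>k\<in>J. \<Sum>i\<in>{i\<in>I. k \<in> \<tau>' i}. c i * x i k)"
      unfolding X_def .
  qed
  have "(\<integral>x. f' i x \<partial>lebJ (\<tau>' i)) = (\<integral>x. f i x \<partial>lebJ (\<tau> i))" if i: "i \<in> I" for i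
  proof (cases "i \<in> I1")
    case True
    have "integrable (lebJ (insert j (\<tau>' i))) (f i)"
      using tame_integrable[OF _ insert.prems(3)[OF i]] fin[OF i] \<tau>1[OF True] by simp
    from lebJ.product_integral_insert[OF fin[OF i] \<tau>1(2)[OF True] this]
    show ?thesis using True \<tau>1(1)[OF True] by (simp add: f'_def)
  next
    case False
    then show ?thesis using \<tau>2[of i] i by (simp add: f'_def)
  qed
  moreover have "(\<integral>x. h' x \<partial>lebJ J) = (\<integral>x. h x \<partial>lebJ (insert j J))"
    unfolding h'_def using tame_integrable[OF _ insert.prems(4)] insert.hyps
    by (intro lebJ.product_integral_insert[symmetric]) auto
  ultimately show ?case using IH by simp
qed

section \<open>Log-concave functions\<close>

text \<open>Substitution in one coordinate at a time, each contributing a factor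
  \<open>1 / c\<close>. It serves for midpoints with a fixed point (\<open>c = 1/2\<close>) and for
  a dilation (\<open>c = 1 / q\<close>).\<close>

lemma lebJ_scale:
  fixes f :: "(nat \<Rightarrow> real) \<Rightarrow> real" and b :: "nat \<Rightarrow> real"
  assumes "finite J" "c > 0" "tame J f"
  shows "tame J (\<lambda>x. f (\<lambda>j\<in>J. b j + c * x j))"
    and "(\<integral>x. f (\<lambda>j\<in>J. b j + c * x j) \<partial>lebJ J) = (\<integral>x. f x \<partial>lebJ J) / c ^ card J"
proof -
  \<comment> \<open>For arbitrary \<open>J\<close> and \<open>f\<close>, because the induction needs
    integrability at every intermediate coordinate set.\<close>
  have tm: "tame J (\<lambda>x. f (\<lambda>j\<in>J. b j + c * x j))" if fin: "finite J" and tf: "tame J f" for J f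
  proof -
    obtain M R where f: "f \<in> borel_measurable (lebJ J)" "M \<ge> 0" "R \<ge> 0"
      "\<And>x. x \<in> PiE J (\<lambda>_. UNIV) \<Longrightarrow> 0 \<le> f x" "\<And>x. x \<in> PiE J (\<lambda>_. UNIV) \<Longrightarrow> f x \<le> M"
      "\<And>x k. x \<in> PiE J (\<lambda>_. UNIV) \<Longrightarrow> f x \<noteq> 0 \<Longrightarrow> k \<in> J \<Longrightarrow> \<bar>x k\<bar> \<le> R"
      using tameE[OF tf] by metis
    show ?thesis
    proof (rule tameI[where M=M and R="(R + (\<Sum>j\<in>J. \<bar>b j\<bar>)) / c"])
      have "(\<lambda>x. \<lambda>j\<in>J. b j + c * x j) \<in> measurable (lebJ J) (lebJ J)" by measurable
      from measurable_compose[OF this f(1)]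
      show "(\<lambda>x. f (\<lambda>j\<in>J. b j + c * x j)) \<in> borel_measurable (lebJ J)" .
      fix x :: "nat \<Rightarrow> real" assume "x \<in> PiE J (\<lambda>_. UNIV)"
      have y: "(\<lambda>j\<in>J. b j + c * x j) \<in> PiE J (\<lambda>_. UNIV)" by auto
      show "0 \<le> f (\<lambda>j\<in>J. b j + c * x j)" "f (\<lambda>j\<in>J. b j + c * x j) \<le> M" using f(4,5)[OF y] by auto
      fix k assume nz: "f (\<lambda>j\<in>J. b j + c * x j) \<noteq> 0" and k: "k \<in> J"
      have "\<bar>b k + c * x k\<bar> \<le> R" using f(6)[OF y nz k] k by simp
      moreover have "\<bar>b k\<bar> \<le> (\<Sum>j\<in>J. \<bar>b j\<bar>)" using fin k by (intro member_le_sum) auto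
      ultimately have "\<bar>c * x k\<bar> \<le> R + (\<Sum>j\<in>J. \<bar>b j\<bar>)" by linarith
      then show "\<bar>x k\<bar> \<le> (R + (\<Sum>j\<in>J. \<bar>b j\<bar>)) / c" using \<open>c > 0\<close> by (simp add: abs_mult field_simps)
    qed
  qed
  then show "tame J (\<lambda>x. f (\<lambda>j\<in>J. b j + c * x j))" using assms by auto
  show "(\<integral>x. f (\<lambda>j\<in>J. b j + c * x j) \<partial>lebJ J) = (\<integral>x. f x \<partial>lebJ J) / c ^ card J"
    using assms(1,3)
  proof (induction J arbitrary: f rule: finite_induct)
    case empty
    then show ?case by (simp add: PiM_empty lebesgue_integral_count_space_finite restrict_def)
  next
    case (insert j J)
    have up: "(\<lambda>k\<in>insert j J. b k + c * (x(j := t)) k) = (\<lambda>k\<in>J. b k + c * x k)(j := b j + c * t)" for x :: "nat \<Rightarrow> real" and t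
      using insert.hyps by (auto simp: fun_eq_iff)
    have "(\<integral>x. f (\<lambda>j\<in>insert j J. b j + c * x j) \<partial>lebJ (insert j J)) =
      (\<integral>x. (\<integral>t. f (\<lambda>k\<in>insert j J. b k + c * (x(j := t)) k) \<partial>lborel) \<partial>lebJ J)"
      using insert.hyps by (intro lebJ.product_integral_insert tame_integrable tm insert.prems) auto
    also have "\<dots> = (\<integral>x. (\<integral>t. f ((\<lambda>k\<in>J. b k + c * x k)(j := t)) \<partial>lborel) / c \<partial>lebJ J)"
      unfolding up
    proof (intro Bochner_Integration.integral_cong refl)
      fix x :: "nat \<Rightarrow> real"
      show "(\<integral>t. f ((\<lambda>k\<in>J. b k + c * x k)(j := b j + c * t)) \<partial>lborel) = (\<integral>t. f ((\<lambda>k\<in>J. b k + c * x k)(j := t)) \<partial>lborel) / c"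
        using lborel_integral_real_affine[of c "\<lambda>t. f ((\<lambda>k\<in>J. b k + c * x k)(j := t))" "b j"] \<open>c > 0\<close> by simp
    qed
    also have "\<dots> = (\<integral>x. (\<integral>t. f ((\<lambda>k\<in>J. b k + c * x k)(j := t)) \<partial>lborel) \<partial>lebJ J) / c"
      by simp
    also have "\<dots> = (\<integral>x. (\<integral>t. f (x(j := t)) \<partial>lborel) \<partial>lebJ J) / c ^ card J / c"
      by (subst insert.IH[OF tame_slice[OF insert.hyps insert.prems]]) simp
    also have "\<dots> = (\<integral>x. f x \<partial>lebJ (insert j J)) / c ^ card (insert j J)"
      using insert.hyps tame_integrable[OF _ insert.prems] by (simp add: lebJ.product_integral_insert)
    finally show ?case .
  qed
qed

text \<open>The functional is extended one coordinate at a time, as in the Hahn--Banach theorem.\<close>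

lemma supporting_hyperplane:
  fixes A :: "((nat \<Rightarrow> real) \<times> real) set"
  assumes J: "finite J"
    and conv: "\<And>x t y u \<theta>. (x, t) \<in> A \<Longrightarrow> (y, u) \<in> A \<Longrightarrow> 0 < \<theta> \<Longrightarrow> \<theta> < 1 \<Longrightarrow>
        ((\<lambda>j. (1 - \<theta>) * x j + \<theta> * y j), (1 - \<theta>) * t + \<theta> * u) \<in> A"
    and le: "\<And>t. ((\<lambda>_. 0), t) \<in> A \<Longrightarrow> t \<le> c"
    and dir: "\<And>j. j \<in> J \<Longrightarrow> \<exists>e>0. \<exists>t. ((\<lambda>_. 0)(j := e), t) \<in> A"
        "\<And>j. j \<in> J \<Longrightarrow> \<exists>e>0. \<exists>t. ((\<lambda>_. 0)(j := -e), t) \<in> A"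
  shows "\<exists>u. \<forall>x t. (x, t) \<in> A \<longrightarrow> (\<forall>j. j \<notin> J \<longrightarrow> x j = 0) \<longrightarrow> t \<le> c + (\<Sum>j\<in>J. u j * x j)"
  using J dir
proof (induction J rule: finite_induct)
  case empty
  have "t \<le> c" if "(x, t) \<in> A" "\<forall>j. x j = 0" for x t
  proof -
    have "x = (\<lambda>_. 0)" using that by auto
    then show ?thesis using le that by blast
  qed
  then show ?case by simp
next
  case (insert k J)
  have "\<exists>u. \<forall>x t. (x, t) \<in> A \<longrightarrow> (\<forall>j. j \<notin> J \<longrightarrow> x j = 0) \<longrightarrow> t \<le> c + (\<Sum>j\<in>J. u j * x j)"
    by (rule insert.IH; rule insert.prems; simp)
  then obtain u where u: "\<And>x t. (x, t) \<in> A \<Longrightarrow> (\<And>j. j \<notin> J \<Longrightarrow> x j = 0) \<Longrightarrow> t \<le> c + (\<Sum>j\<in>J. u j * x j)"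
    by blast
  define L where "L x = c + (\<Sum>j\<in>J. u j * x j)" for x
  \<comment> \<open>The new coefficient \<open>w\<close> must satisfy
    \<open>t \<le> L x + w * x k\<close> on \<open>A\<close>. Points with \<open>x k > 0\<close>
    bound it from below by the elements of \<open>P\<close>, those with \<open>x k < 0\<close> from
    above by the elements of \<open>Q\<close>.\<close>
  define P where "P = {(t - L x) / x k |x t. (x, t) \<in> A \<and> (\<forall>j. j \<notin> insert k J \<longrightarrow> x j = 0) \<and> x k > 0}"
  define Q where "Q = {(t - L x) / x k |x t. (x, t) \<in> A \<and> (\<forall>j. j \<notin> insert k J \<longrightarrow> x j = 0) \<and> x k < 0}"
  have PQ: "p \<le> q" if pq: "p \<in> P" "q \<in> Q" for p q
  proof -
    obtain x t where x: "(x, t) \<in> A" "\<And>j. j \<notin> insert k J \<Longrightarrow> x j = 0" "x k > 0" and p: "p = (t - L x) / x k"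
      using pq(1) unfolding P_def by auto
    obtain y s where y: "(y, s) \<in> A" "\<And>j. j \<notin> insert k J \<Longrightarrow> y j = 0" "y k < 0" and q: "q = (s - L y) / y k"
      using pq(2) unfolding Q_def by auto
    define D where "D = x k - y k"
    have D: "D > 0" using x y by (simp add: D_def)
    \<comment> \<open>The weight at which the segment from \<open>x\<close> to \<open>y\<close> has
      \<open>k\<close>-th coordinate 0, where the induction hypothesis already controls the
      height.\<close>
    define \<theta> where "\<theta> = x k / D"
    have \<theta>: "0 < \<theta>" "\<theta> < 1" "1 - \<theta> = - y k / D" using x y D by (auto simp: \<theta>_def D_def field_simps)
    define z where "z = (\<lambda>j. (1 - \<theta>) * x j + \<theta> * y j)"
    have zA: "(z, (1 - \<theta>) * t + \<theta> * s) \<in> A" unfolding z_def by (rule conv[OF x(1) y(1) \<theta>(1,2)])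
    have "z k = 0" unfolding z_def \<theta>(3) using D by (simp add: \<theta>_def field_simps)
    then have "z j = 0" if "j \<notin> J" for j using that x(2)[of j] y(2)[of j] by (cases "j = k") (auto simp: z_def)
    from u[OF zA this] have "(1 - \<theta>) * t + \<theta> * s \<le> L z" by (simp add: L_def)
    also have "L z = (1 - \<theta>) * L x + \<theta> * L y"
      by (simp add: L_def z_def sum.distrib sum_distrib_left algebra_simps sum_subtractf)
    finally have "(1 - \<theta>) * (t - L x) + \<theta> * (s - L y) \<le> 0" by (simp add: algebra_simps)
    then have "(- y k * (t - L x) + x k * (s - L y)) / D \<le> 0"
      unfolding \<theta>(3) by (simp add: \<theta>_def add_divide_distrib diff_divide_distrib)
    then have "- y k * (t - L x) + x k * (s - L y) \<le> 0" using D by (simp add: divide_le_0_iff)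
    then show ?thesis unfolding p q using x(3) y(3) by (simp add: field_simps)
  qed
  \<comment> \<open>Points of \<open>A\<close> on both sides along the axis \<open>k\<close> make
    \<open>P\<close> and \<open>Q\<close> nonempty, so \<open>Sup P\<close> is a legitimate choice
    of \<open>w\<close> lying between them.\<close>
  obtain p0 where p0: "p0 \<in> P"
  proof -
    obtain e t where "e > 0" "((\<lambda>_. 0)(k := e), t) \<in> A" using insert.prems(1)[of k] by blast
    then have "(t - L ((\<lambda>_. 0)(k := e))) / e \<in> P" unfolding P_def
      by (intro CollectI exI[of _ "(\<lambda>_. 0)(k := e)"] exI[of _ t]) auto
    then show ?thesis using that by blast
  qed
  obtain q0 where q0: "q0 \<in> Q"
  proof -
    obtain e t where "e > 0" "((\<lambda>_. 0)(k := -e), t) \<in> A" using insert.prems(2)[of k] by blast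
    then have "(t - L ((\<lambda>_. 0)(k := -e))) / (-e) \<in> Q" unfolding Q_def
      by (intro CollectI exI[of _ "(\<lambda>_. 0)(k := -e)"] exI[of _ t]) auto
    then show ?thesis using that by blast
  qed
  define w where "w = Sup P"
  have bdd: "bdd_above P" using PQ[OF _ q0] by (auto simp: bdd_above_def)
  have wP: "p \<le> w" if "p \<in> P" for p unfolding w_def using that bdd by (rule cSup_upper)
  have wQ: "w \<le> q" if "q \<in> Q" for q unfolding w_def using p0 PQ that by (intro cSup_least) auto
  have "t \<le> c + (\<Sum>j\<in>insert k J. (u(k := w)) j * x j)" if x: "(x, t) \<in> A" "\<And>j. j \<notin> insert k J \<Longrightarrow> x j = 0" for x t
  proof -
    have eq: "c + (\<Sum>j\<in>insert k J. (u(k := w)) j * x j) = L x + w * x k"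
    proof -
      have "(\<Sum>j\<in>J. (u(k := w)) j * x j) = (\<Sum>j\<in>J. u j * x j)"
        using insert.hyps by (intro sum.cong) auto
      then show ?thesis using insert.hyps by (simp add: L_def)
    qed
    consider "x k > 0" | "x k < 0" | "x k = 0" by linarith
    then show ?thesis unfolding eq
    proof cases
      case 1
      then have "(t - L x) / x k \<in> P" unfolding P_def using x by blast
      from wP[OF this] 1 show "t \<le> L x + w * x k" by (simp add: field_simps)
    next
      case 2
      then have "(t - L x) / x k \<in> Q" unfolding Q_def using x by blast
      from wQ[OF this] 2 show "t \<le> L x + w * x k" by (simp add: field_simps)
    next
      case 3
      then have "x j = 0" if "j \<notin> J" for j using x(2)[of j] that by (cases "j = k") auto
      from u[OF x(1) this] 3 show "t \<le> L x + w * x k" by (simp add: L_def)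
    qed
  qed
  then show ?case by (intro exI[of _ "u(k := w)"]) blast
qed

text \<open>The functions live on all of \<open>nat \<Rightarrow> real\<close>, so convex
  combinations need no restriction to a coordinate set; dependence on \<open>J\<close> alone is
  expressed by \<open>f (restrict x J) = f x\<close> where it matters. Since
  \<open>0 powr a = 0\<close>, the inequality is trivial where \<open>f x\<close> or
  \<open>f y\<close> vanishes.\<close>

definition log_concave :: "((nat \<Rightarrow> real) \<Rightarrow> real) \<Rightarrow> bool" where
  "log_concave f \<longleftrightarrow> (\<forall>x. 0 \<le> f x) \<and> (\<forall>x y \<theta>. 0 < \<theta> \<longrightarrow> \<theta> < 1 \<longrightarrow>
     f x powr (1 - \<theta>) * f y powr \<theta> \<le> f (\<lambda>j. (1 - \<theta>) * x j + \<theta> * y j))"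

lemma log_concaveD:
  assumes "log_concave f"
  shows "0 \<le> f x"
    and "0 < \<theta> \<Longrightarrow> \<theta> < 1 \<Longrightarrow> f x powr (1 - \<theta>) * f y powr \<theta> \<le> f (\<lambda>j. (1 - \<theta>) * x j + \<theta> * y j)"
  using assms by (auto simp: log_concave_def)

text \<open>Induction on the number of points: all points but \<open>x a\<close> are merged into
  one, with their weights renormalised by the sum \<open>\<theta>\<close>.\<close>

lemma log_concave_prod:
  fixes c :: "'i \<Rightarrow> real"
  assumes f: "log_concave f" and "finite I" "I \<noteq> {}" "\<And>i. i \<in> I \<Longrightarrow> c i > 0" "(\<Sum>i\<in>I. c i) = 1"
  shows "(\<Prod>i\<in>I. f (x i) powr c i) \<le> f (\<lambda>j. \<Sum>i\<in>I. c i * x i j)"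
  using assms(2-)
proof (induction I arbitrary: c rule: finite_ne_induct)
  case (singleton a)
  then show ?case using log_concaveD(1)[OF f] by simp
next
  case (insert a I)
  define \<theta> where "\<theta> = (\<Sum>i\<in>I. c i)"
  have "\<theta> > 0" unfolding \<theta>_def using insert by (intro sum_pos) auto
  moreover have \<theta>1: "c a = 1 - \<theta>" using insert by (simp add: \<theta>_def)
  moreover have "c a > 0" using insert by auto
  ultimately have \<theta>: "0 < \<theta>" "\<theta> < 1" by auto
  let ?y = "\<lambda>j. \<Sum>i\<in>I. c i / \<theta> * x i j"
  have IH: "(\<Prod>i\<in>I. f (x i) powr (c i / \<theta>)) \<le> f ?y"
    using insert.prems \<theta> by (intro insert.IH) (auto simp: \<theta>_def sum_divide_distrib[symmetric])
  have "(\<Prod>i\<in>I. f (x i) powr c i) = (\<Prod>i\<in>I. (f (x i) powr (c i / \<theta>)) powr \<theta>)"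
    using \<theta> by (simp add: powr_powr)
  also have "\<dots> = (\<Prod>i\<in>I. f (x i) powr (c i / \<theta>)) powr \<theta>"
    by (rule prod_powr_distrib[symmetric])
  also have "\<dots> \<le> f ?y powr \<theta>"
    using IH \<theta> by (intro powr_mono2) (auto intro: prod_nonneg)
  finally have "(\<Prod>i\<in>insert a I. f (x i) powr c i) \<le> f (x a) powr (1 - \<theta>) * f ?y powr \<theta>"
    using insert.hyps \<theta>1 by (simp add: mult_left_mono)
  also have "\<dots> \<le> f (\<lambda>j. (1 - \<theta>) * x a j + \<theta> * ?y j)"
    by (rule log_concaveD(2)[OF f \<theta>])
  also have "(\<lambda>j. (1 - \<theta>) * x a j + \<theta> * ?y j) = (\<lambda>j. \<Sum>i\<in>insert a I. c i * x i j)"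
    using insert.hyps \<theta> \<theta>1 by (simp add: sum_distrib_left fun_eq_iff)
  finally show ?case .
qed

lemma tame_coord_integrable:
  assumes "finite J" "tame J f" "j \<in> J"
  shows "integrable (lebJ J) (\<lambda>x. x j * f x)"
proof -
  obtain M R where f: "f \<in> borel_measurable (lebJ J)" "M \<ge> 0" "R \<ge> 0"
    "\<And>x. x \<in> PiE J (\<lambda>_. UNIV) \<Longrightarrow> 0 \<le> f x" "\<And>x. x \<in> PiE J (\<lambda>_. UNIV) \<Longrightarrow> f x \<le> M"
    "\<And>x k. x \<in> PiE J (\<lambda>_. UNIV) \<Longrightarrow> f x \<noteq> 0 \<Longrightarrow> k \<in> J \<Longrightarrow> \<bar>x k\<bar> \<le> R"
    using tameE[OF assms(2)] by metis
  show ?thesis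
  proof (rule Bochner_Integration.integrable_bound[of _ "\<lambda>x. R * f x"])
    show "integrable (lebJ J) (\<lambda>x. R * f x)"
      using tame_integrable[OF assms(1,2)] by simp
    show "(\<lambda>x. x j * f x) \<in> borel_measurable (lebJ J)"
      using f(1) assms(3) by measurable
    show "AE x in lebJ J. norm (x j * f x) \<le> norm (R * f x)"
    proof (rule AE_I2)
      fix x assume "x \<in> space (lebJ J)"
      then have x: "x \<in> PiE J (\<lambda>_. UNIV)" by (simp add: space_lebJ)
      show "norm (x j * f x) \<le> norm (R * f x)"
        using f(6)[OF x _ assms(3)] f(3) by (cases "f x = 0") (auto simp: abs_mult intro!: mult_right_mono)
    qed
  qed
qed

text \<open>The base 4 is the square of the factor 2 that each coordinate contributes to the
  integral of \<open>f\<close> at the midpoint of \<open>x\<close> and \<open>x0\<close>.\<close>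

lemma log_concave_le_at_centroid:
  fixes f :: "(nat \<Rightarrow> real) \<Rightarrow> real"
  assumes J: "finite J" and f: "log_concave f" and tf: "tame J f" and dep: "\<And>x. f (restrict x J) = f x"
    and cent: "\<And>j. j \<in> J \<Longrightarrow> (\<integral>x. x j * f x \<partial>lebJ J) = 0"
    and pos: "(\<integral>x. f x \<partial>lebJ J) > 0" and e: "e > 0"
    and nbhd: "\<And>x. (\<And>j. j \<in> J \<Longrightarrow> \<bar>x j\<bar> < e) \<Longrightarrow> f x > 0"
  shows "f x0 \<le> 4 ^ card J * f (\<lambda>_. 0)"
proof (cases "f x0 = 0")
  case True
  then show ?thesis using log_concaveD(1)[OF f] by simp
next
  case False
  then have M: "f x0 > 0" using log_concaveD(1)[OF f, of x0] by simp
  define a where "a = f (\<lambda>_. 0)"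
  have a: "a > 0" unfolding a_def using e by (intro nbhd) auto
  \<comment> \<open>The region below the graph of \<open>ln f\<close>, convex by log-concavity. Its
    supporting hyperplane over the origin supplies \<open>u\<close>.\<close>
  define A where "A = {(x, t). f x > 0 \<and> t \<le> ln (f x)}"
  have "\<exists>u. \<forall>x t. (x, t) \<in> A \<longrightarrow> (\<forall>j. j \<notin> J \<longrightarrow> x j = 0) \<longrightarrow> t \<le> ln a + (\<Sum>j\<in>J. u j * x j)"
  proof (rule supporting_hyperplane[OF J])
    fix x t y u and \<theta> :: real
    assume A: "(x, t) \<in> A" "(y, u) \<in> A" and \<theta>: "0 < \<theta>" "\<theta> < 1"
    let ?z = "\<lambda>j. (1 - \<theta>) * x j + \<theta> * y j"
    have p: "f x > 0" "f y > 0" "t \<le> ln (f x)" "u \<le> ln (f y)" using A by (auto simp: A_def)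
    have le: "f x powr (1 - \<theta>) * f y powr \<theta> \<le> f ?z" by (rule log_concaveD(2)[OF f \<theta>])
    have z0: "0 < f x powr (1 - \<theta>) * f y powr \<theta>" using p by simp
    have "(1 - \<theta>) * t + \<theta> * u \<le> (1 - \<theta>) * ln (f x) + \<theta> * ln (f y)"
      using p \<theta> by (intro add_mono mult_left_mono) auto
    also have "\<dots> = ln (f x powr (1 - \<theta>) * f y powr \<theta>)" using p by (simp add: ln_mult ln_powr)
    also have "\<dots> \<le> ln (f ?z)" using le z0 by simp
    finally show "(?z, (1 - \<theta>) * t + \<theta> * u) \<in> A" using le z0 by (simp add: A_def)
  next
    fix t assume "((\<lambda>_. 0), t) \<in> A" then show "t \<le> ln a" by (simp add: A_def a_def)
  next
    fix j
    have p: "f ((\<lambda>_. 0)(j := e/2)) > 0" "f ((\<lambda>_. 0)(j := -(e/2))) > 0" using e by (auto intro!: nbhd)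
    show "\<exists>e>0. \<exists>t. ((\<lambda>_. 0)(j := e), t) \<in> A"
      by (rule exI[of _ "e/2"]) (use e p in \<open>auto simp: A_def\<close>)
    show "\<exists>e>0. \<exists>t. ((\<lambda>_. 0)(j := -e), t) \<in> A"
      by (rule exI[of _ "e/2"]) (use e p in \<open>auto simp: A_def\<close>)
  qed
  then obtain u where u: "\<And>x t. (x, t) \<in> A \<Longrightarrow> (\<forall>j. j \<notin> J \<longrightarrow> x j = 0) \<Longrightarrow> t \<le> ln a + (\<Sum>j\<in>J. u j * x j)"
    by blast
  define \<phi> where "\<phi> x = (\<Sum>j\<in>J. u j * x j)" for x
  have bound: "f x \<le> a * exp (\<phi> x)" for x
  proof (cases "f x = 0")
    case True then show ?thesis using a by simp
  next
    case False
    then have fx: "f x > 0" using log_concaveD(1)[OF f, of x] by simp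
    \<comment> \<open>The hyperplane bound concerns points that vanish off \<open>J\<close>, while
      \<open>f\<close> does not see those coordinates.\<close>
    let ?x = "\<lambda>j. if j \<in> J then x j else 0"
    have "f ?x = f (restrict ?x J)" by (rule dep[symmetric])
    also have "restrict ?x J = restrict x J" by (auto simp: fun_eq_iff)
    also have "f \<dots> = f x" by (rule dep)
    finally have eq: "f ?x = f x" .
    have "ln (f x) \<le> ln a + (\<Sum>j\<in>J. u j * ?x j)"
      by (rule u) (use fx eq in \<open>auto simp: A_def\<close>)
    also have "(\<Sum>j\<in>J. u j * ?x j) = \<phi> x" by (simp add: \<phi>_def)
    finally have "exp (ln (f x)) \<le> exp (ln a + \<phi> x)" by simp
    then show ?thesis using fx a by (simp add: exp_add)
  qed
  let ?m = "\<lambda>x. f (\<lambda>j\<in>J. x0 j / 2 + 1/2 * x j)"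
  have int1: "integrable (lebJ J) ?m"
    using lebJ_scale(1)[OF J _ tf, of "1/2" "\<lambda>j. x0 j / 2"] by (intro tame_integrable[OF J]) simp
  \<comment> \<open>Three inequalities are chained: the exponential bound replaces one of the two
    factors \<open>sqrt (f x)\<close> of \<open>f x\<close>, then
    \<open>exp (- v) \<ge> 1 - v\<close> linearises it, and finally log-concavity at the midpoint
    with \<open>x0\<close> is used.\<close>
  have key: "sqrt (f x0) / sqrt a * (f x - 1/2 * (\<Sum>j\<in>J. u j * (x j * f x))) \<le> ?m x" for x
  proof (cases "f x = 0")
    case True
    then show ?thesis using log_concaveD(1)[OF f] by simp
  next
    case False
    then have fx: "f x > 0" using log_concaveD(1)[OF f, of x] by simp
    have "sqrt (f x) * sqrt (f x) \<le> sqrt (a * exp (\<phi> x)) * sqrt (f x)"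
      using bound[of x] fx by (intro mult_right_mono) auto
    moreover have "sqrt (exp (\<phi> x)) = exp (\<phi> x / 2)"
      by (rule real_sqrt_unique) (simp_all add: power2_eq_square flip: exp_add)
    ultimately have "f x \<le> sqrt a * exp (\<phi> x / 2) * sqrt (f x)"
      using fx by (simp add: real_sqrt_mult)
    then have "f x / sqrt a * exp (- (\<phi> x / 2)) \<le> sqrt (f x)"
      using a by (simp add: exp_minus field_simps)
    moreover have "f x / sqrt a * (1 - \<phi> x / 2) \<le> f x / sqrt a * exp (- (\<phi> x / 2))"
      using exp_ge_add_one_self[of "- (\<phi> x / 2)"] fx a by (intro mult_left_mono) auto
    ultimately have "f x / sqrt a * (1 - \<phi> x / 2) \<le> sqrt (f x)" by linarith
    then have "sqrt (f x0) * (f x / sqrt a * (1 - \<phi> x / 2)) \<le> sqrt (f x0) * sqrt (f x)"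
      using M by (intro mult_left_mono) auto
    also have "\<dots> = f x0 powr (1 - 1/2) * f x powr (1/2)" using M fx by (simp add: powr_half_sqrt)
    also have "\<dots> \<le> f (\<lambda>j. (1 - 1/2) * x0 j + 1/2 * x j)" by (rule log_concaveD(2)[OF f]) auto
    also have "\<dots> = f (restrict (\<lambda>j. (1 - 1/2) * x0 j + 1/2 * x j) J)" by (rule dep[symmetric])
    also have "restrict (\<lambda>j. (1 - 1/2) * x0 j + 1/2 * x j) J = (\<lambda>j\<in>J. x0 j / 2 + 1/2 * x j)"
      by (auto simp: fun_eq_iff)
    finally have "sqrt (f x0) * (f x / sqrt a * (1 - \<phi> x / 2)) \<le> ?m x" .
    moreover have "(\<Sum>j\<in>J. u j * (x j * f x)) = \<phi> x * f x"
      by (simp add: \<phi>_def sum_distrib_right mult.assoc)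
    ultimately show ?thesis by (simp add: algebra_simps)
  qed
  have ints: "integrable (lebJ J) (\<lambda>x. x j * f x)" if "j \<in> J" for j
    using tame_coord_integrable[OF J tf that] .
  have intf: "integrable (lebJ J) f" by (rule tame_integrable[OF J tf])
  \<comment> \<open>The centroid condition removes the linear terms from the integral.\<close>
  have "sqrt (f x0) / sqrt a * (\<integral>x. f x \<partial>lebJ J) =
      (\<integral>x. sqrt (f x0) / sqrt a * (f x - 1/2 * (\<Sum>j\<in>J. u j * (x j * f x))) \<partial>lebJ J)"
    using ints intf cent by (simp add: integral_sum)
  also have "\<dots> \<le> (\<integral>x. ?m x \<partial>lebJ J)"
    using ints intf int1 key by (intro integral_mono) auto
  also have "\<dots> = 2 ^ card J * (\<integral>x. f x \<partial>lebJ J)"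
    using lebJ_scale(2)[OF J _ tf, of "1/2" "\<lambda>j. x0 j / 2"] by (simp add: power_one_over field_simps)
  finally have "sqrt (f x0) / sqrt a \<le> 2 ^ card J" using pos by (rule mult_right_le_imp_le)
  then have "sqrt (f x0) \<le> 2 ^ card J * sqrt a" using a by (simp add: field_simps)
  then have "(sqrt (f x0))\<^sup>2 \<le> (2 ^ card J * sqrt a)\<^sup>2" using M by (intro power_mono) auto
  also have "\<dots> = (2 ^ card J)\<^sup>2 * a" using a by (simp add: power_mult_distrib)
  also have "(2 ^ card J)\<^sup>2 = (4 :: real) ^ card J" by (simp add: power2_eq_square flip: power_mult_distrib)
  finally show ?thesis using M by (simp add: a_def)
qed

text \<open>The reverse Brascamp-Lieb inequality puts weight \<open>1 / m\<close> on each set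
  containing a given coordinate, while log-concavity averages all \<open>r\<close> points with
  weights \<open>1 / r\<close>. The power \<open>q = r / m\<close> and the dilation by
  \<open>1 / q\<close> reconcile the two, at the price of the factor
  \<open>q ^ card J\<close>.\<close>

lemma log_concave_uniform_cover:
  fixes f :: "(nat \<Rightarrow> real) \<Rightarrow> real" and \<tau> :: "'i \<Rightarrow> nat set"
  assumes J: "finite J" and f: "log_concave f" and tf: "tame J f" and dep: "\<And>x. f (restrict x J) = f x"
    and M: "\<And>x. f x \<le> M"
    and I: "finite I" "card I = r" and r: "m \<ge> 1" "m \<le> r"
    and \<tau>: "\<And>i. i \<in> I \<Longrightarrow> \<tau> i \<subseteq> J" "\<And>j. j \<in> J \<Longrightarrow> card {i\<in>I. j \<in> \<tau> i} = m"
    and ft: "\<And>i. i \<in> I \<Longrightarrow> tame (\<tau> i) (\<lambda>y. f (\<lambda>j. if j \<in> \<tau> i then y j else 0))"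
  shows "(\<Prod>i\<in>I. \<integral>y. f (\<lambda>j. if j \<in> \<tau> i then y j else 0) \<partial>lebJ (\<tau> i))
    \<le> (r / m) ^ (card J * m) * M ^ (r - m) * (\<integral>y. f y \<partial>lebJ J) ^ m"
proof -
  define q where "q = real r / real m"
  have q: "q \<ge> 1" using r by (simp add: q_def)
  have rm: "real r > 0" "real m > 0" using r by auto
  have f0: "0 \<le> f x" for x by (rule log_concaveD(1)[OF f])
  have M0: "M \<ge> 0" using M f0 order_trans by blast
  \<comment> \<open>Comparing \<open>f x powr q\<close> with a multiple of \<open>f x\<close> is
    where the upper bound \<open>M\<close> enters.\<close>
  have fq: "f x powr q \<le> M powr (q - 1) * f x" for x
  proof (cases "f x = 0")
    case False
    have "f x powr q = f x powr (q - 1) * f x powr 1" unfolding powr_add[symmetric] by simp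
    also have "\<dots> \<le> M powr (q - 1) * f x powr 1"
      using f0 M q by (intro mult_right_mono powr_mono2) auto
    finally show ?thesis using f0[of x] by simp
  qed (use q in simp)
  define g where "g x = f x powr q" for x
  have tg: "tame J g"
  proof -
    have fm: "f \<in> borel_measurable (lebJ J)" using tf by (simp add: tame_def)
    obtain R where R: "\<forall>x \<in> PiE J (\<lambda>_. UNIV). f x \<noteq> 0 \<longrightarrow> (\<forall>j\<in>J. \<bar>x j\<bar> \<le> R)"
      using tf unfolding tame_def by blast
    show ?thesis
    proof (rule tameI[where M="M powr q" and R=R])
      show "g \<in> borel_measurable (lebJ J)" unfolding g_def using fm by measurable
      show "g x \<le> M powr q" for x unfolding g_def using q f0 M by (intro powr_mono2) auto
    qed (use R in \<open>auto simp: g_def\<close>)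
  qed
  let ?F = "\<lambda>i y. f (\<lambda>j. if j \<in> \<tau> i then y j else 0)"
  let ?h = "\<lambda>x. g (\<lambda>j\<in>J. 0 + 1 / q * x j)"
  have th: "tame J ?h" "(\<integral>x. ?h x \<partial>lebJ J) = (\<integral>x. g x \<partial>lebJ J) / (1 / q) ^ card J"
    using lebJ_scale[OF J _ tg, of "1 / q" "\<lambda>_. 0"] q by auto
  have "(\<Prod>i\<in>I. (\<integral>y. ?F i y \<partial>lebJ (\<tau> i)) powr (1 / real m)) \<le> (\<integral>x. ?h x \<partial>lebJ J)"
  proof (rule coordinate_reverse_brascamp_lieb[OF J I(1) _ \<tau>(1) _ ft th(1)])
    show "1 / real m > 0" using r by simp
    show "(\<Sum>i\<in>{i\<in>I. j \<in> \<tau> i}. 1 / real m) = 1" if "j \<in> J" for j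
      using \<tau>(2)[OF that] r by simp
    fix x :: "'i \<Rightarrow> nat \<Rightarrow> real"
    let ?z = "\<lambda>i j. if j \<in> \<tau> i then x i j else 0"
    have "(\<Prod>i\<in>I. f (?z i) powr (1 / real m)) = (\<Prod>i\<in>I. (f (?z i) powr (1 / real r)) powr q)"
      using rm by (simp add: powr_powr q_def)
    also have "\<dots> = (\<Prod>i\<in>I. f (?z i) powr (1 / real r)) powr q"
      by (rule prod_powr_distrib[symmetric])
    also have "\<dots> \<le> f (\<lambda>j. \<Sum>i\<in>I. 1 / real r * ?z i j) powr q"
    proof (intro powr_mono2 prod_nonneg log_concave_prod[OF f I(1)])
      show "I \<noteq> {}" using I r by auto
    qed (use q rm I in auto)
    also have "f (\<lambda>j. \<Sum>i\<in>I. 1 / real r * ?z i j) = f (restrict (\<lambda>j. \<Sum>i\<in>I. 1 / real r * ?z i j) J)"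
      by (rule dep[symmetric])
    \<comment> \<open>Zero extension turns the sum over all \<open>i\<close> into one over those
      with \<open>j \<in> \<tau> i\<close>, and \<open>1 / r = 1 / q * (1 / m)\<close>.\<close>
    also have "restrict (\<lambda>j. \<Sum>i\<in>I. 1 / real r * ?z i j) J =
       (\<lambda>j\<in>J. 0 + 1 / q * (\<lambda>j\<in>J. \<Sum>i\<in>{i\<in>I. j \<in> \<tau> i}. 1 / real m * x i j) j)"
    proof
      fix j
      have "(\<Sum>i\<in>I. 1 / real r * ?z i j) = 1 / q * (\<Sum>i\<in>{i\<in>I. j \<in> \<tau> i}. 1 / real m * x i j)"
        unfolding sum_distrib_left sum.inter_filter[OF I(1)]
        using rm by (intro sum.cong) (auto simp: q_def)
      then show "restrict (\<lambda>j. \<Sum>i\<in>I. 1 / real r * ?z i j) J j =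
       (\<lambda>j\<in>J. 0 + 1 / q * (\<lambda>j\<in>J. \<Sum>i\<in>{i\<in>I. j \<in> \<tau> i}. 1 / real m * x i j) j) j" by simp
    qed
    finally show "(\<Prod>i\<in>I. ?F i (x i) powr (1 / real m)) \<le> ?h (\<lambda>j\<in>J. \<Sum>i\<in>{i\<in>I. j \<in> \<tau> i}. 1 / real m * x i j)"
      unfolding g_def .
  qed
  also have "\<dots> = q ^ card J * (\<integral>x. g x \<partial>lebJ J)"
    using th(2) q by (simp add: power_one_over field_simps)
  also have "\<dots> \<le> q ^ card J * (\<integral>x. M powr (q - 1) * f x \<partial>lebJ J)"
    using fq[folded g_def] q tame_integrable[OF J tg] tame_integrable[OF J tf]
    by (intro mult_left_mono integral_mono) auto
  finally have le: "(\<Prod>i\<in>I. (\<integral>y. ?F i y \<partial>lebJ (\<tau> i)) powr (1 / real m)) \<le>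
      q ^ card J * (M powr (q - 1) * (\<integral>y. f y \<partial>lebJ J))" by simp
  have Fi0: "0 \<le> (\<integral>y. ?F i y \<partial>lebJ (\<tau> i))" for i
    using f0 by (intro Bochner_Integration.integral_nonneg) auto
  have root: "(v powr (1 / real m)) ^ m = v" if "v \<ge> 0" for v :: real
    using that r by (cases "v = 0") (auto simp: powr_powr simp flip: powr_realpow)
  have "(\<Prod>i\<in>I. \<integral>y. ?F i y \<partial>lebJ (\<tau> i)) = (\<Prod>i\<in>I. (\<integral>y. ?F i y \<partial>lebJ (\<tau> i)) powr (1 / real m)) ^ m"
    unfolding prod_power_distrib using root Fi0 by simp
  also have "\<dots> \<le> (q ^ card J * (M powr (q - 1) * (\<integral>y. f y \<partial>lebJ J))) ^ m"
    by (intro power_mono le prod_nonneg) auto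
  also have "\<dots> = q ^ (card J * m) * (M powr (q - 1)) ^ m * (\<integral>y. f y \<partial>lebJ J) ^ m"
    by (simp add: power_mult_distrib power_mult)
  \<comment> \<open>Only an inequality holds in general: for \<open>M = 0\<close> and
    \<open>r = m\<close> the left-hand side is 0, because \<open>0 powr 0 = 0\<close>, but the
    right-hand side is \<open>0 ^ 0 = 1\<close>.\<close>
  also have "(M powr (q - 1)) ^ m \<le> M ^ (r - m)"
  proof (cases "M = 0")
    case True then show ?thesis using r by (simp add: power_0_left)
  next
    case False
    then have "(M powr (q - 1)) ^ m = M powr ((q - 1) * m)" using M0 by (simp add: powr_power mult.commute)
    also have "(q - 1) * m = real (r - m)" using r by (simp add: q_def field_simps of_nat_diff)
    also have "M powr \<dots> = M ^ (r - m)" using False M0 by (simp add: powr_realpow)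
    finally show ?thesis by simp
  qed
  finally show ?thesis
    using q f0 by (simp add: q_def mult_right_mono mult_left_mono)
qed

section \<open>Sections of convex bodies\<close>

text \<open>Block version of \<open>tame_slice\<close>, for integrating out the coordinates outside
  \<open>\<sigma>\<close> at once.\<close>

lemma tame_merge:
  assumes IJ: "finite I" "finite J" "I \<inter> J = {}" and g: "tame (I \<union> J) g"
  shows "tame I (\<lambda>x. \<integral>w. g (merge I J (x, w)) \<partial>lebJ J)"
proof -
  obtain M R where f: "g \<in> borel_measurable (lebJ (I \<union> J))" "M \<ge> 0" "R \<ge> 0"
    "\<And>x. x \<in> PiE (I \<union> J) (\<lambda>_. UNIV) \<Longrightarrow> 0 \<le> g x" "\<And>x. x \<in> PiE (I \<union> J) (\<lambda>_. UNIV) \<Longrightarrow> g x \<le> M"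
    "\<And>x k. x \<in> PiE (I \<union> J) (\<lambda>_. UNIV) \<Longrightarrow> g x \<noteq> 0 \<Longrightarrow> k \<in> I \<union> J \<Longrightarrow> \<bar>x k\<bar> \<le> R"
    using tameE[OF g] by metis
  have mg: "merge I J (x, w) \<in> PiE (I \<union> J) (\<lambda>_. UNIV)" for x w :: "nat \<Rightarrow> real"
    by (auto simp: merge_def PiE_iff extensional_def)
  let ?B = "PiE J (\<lambda>j. {-R..R})"
  interpret sigma_finite_measure "lebJ J"
    using IJ(2) by (rule lebJ.sigma_finite)
  show ?thesis
  proof (rule tameI[where M="M * measure (lebJ J) ?B" and R=R])
    show "(\<lambda>x. \<integral>w. g (merge I J (x, w)) \<partial>lebJ J) \<in> borel_measurable (lebJ I)"
      using measurable_compose[OF measurable_merge f(1)]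
      by (intro borel_measurable_lebesgue_integral) (simp add: case_prod_beta')
  next
    fix x :: "nat \<Rightarrow> real" assume x: "x \<in> PiE I (\<lambda>_. UNIV)"
    show "0 \<le> (\<integral>w. g (merge I J (x, w)) \<partial>lebJ J)" using f(4)[OF mg] by simp
    have le: "g (merge I J (x, w)) \<le> M * indicator ?B w" if w: "w \<in> PiE J (\<lambda>_. UNIV)" for w
    proof (cases "g (merge I J (x, w)) = 0")
      case False
      have "\<bar>w k\<bar> \<le> R" if "k \<in> J" for k
        using f(6)[OF mg False, of k] that IJ(3) by (auto simp: merge_def split: if_splits)
      then have "w \<in> ?B" using w by (auto simp: PiE_iff abs_le_iff minus_le_iff)
      then show ?thesis using f(5)[OF mg] by simp
    qed (simp add: f(2))
    have "(\<integral>w. g (merge I J (x, w)) \<partial>lebJ J) \<le> (\<integral>w. M * indicator ?B w \<partial>lebJ J)"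
    proof (rule integral_mono_AE')
      show "integrable (lebJ J) (\<lambda>w. M * indicator ?B w)"
        using box_fmeasurable[OF IJ(2), of "\<lambda>_. -R" "\<lambda>_. R"]
        by (intro integrable_mult_right integrable_real_indicator) (auto simp: fmeasurable_def)
    qed (use le f(2) in \<open>auto simp: space_lebJ intro!: AE_I2\<close>)
    also have "\<dots> = M * measure (lebJ J) ?B"
      using box_fmeasurable[OF IJ(2), of "\<lambda>_. -R" "\<lambda>_. R"] by (simp add: fmeasurable_def)
    finally show "(\<integral>w. g (merge I J (x, w)) \<partial>lebJ J) \<le> M * measure (lebJ J) ?B" .
    fix k assume nz: "(\<integral>w. g (merge I J (x, w)) \<partial>lebJ J) \<noteq> 0" and k: "k \<in> I"
    have "\<exists>w. g (merge I J (x, w)) \<noteq> 0" using nz by (auto intro: ccontr)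
    then obtain w where w: "g (merge I J (x, w)) \<noteq> 0" by blast
    from f(6)[OF mg w, of k] show "\<bar>x k\<bar> \<le> R" using k by (simp add: merge_def)
  qed
qed

text \<open>Compactness refers to the product topology on all functions
  \<open>nat \<Rightarrow> real\<close>, so \<open>K\<close> is Borel there, and the identity map
  pulls this back to \<open>lebJ {1..n}\<close>. It is measurable since the coordinates outside
  \<open>{1..n}\<close> are constant on that space.\<close>

lemma convex_bodyD:
  assumes "convex_body n K"
  shows "K \<in> sets (lebJ {1..n})" "\<exists>R. \<forall>x\<in>K. \<forall>j\<in>{1..n}. \<bar>x j\<bar> \<le> R" "K \<subseteq> PiE {1..n} (\<lambda>_. UNIV)"
proof -
  have K: "K \<subseteq> Rn n" "compact K" using assms by (auto simp: convex_body_def)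
  show sub: "K \<subseteq> PiE {1..n} (\<lambda>_. UNIV)" using K by (simp add: Rn_def)
  have "(\<lambda>x. x) \<in> measurable (lebJ {1..n}) (PiM UNIV (\<lambda>_. borel :: real measure))"
  proof (rule measurable_PiM_single')
    fix i :: nat
    show "(\<lambda>x. x i) \<in> measurable (lebJ {1..n}) borel"
    proof (cases "i \<in> {1..n}")
      case True
      then show ?thesis using measurable_component_singleton[of i "{1..n}" "\<lambda>_. lborel :: real measure"] by simp
    next
      case False
      then have "x i = undefined" if "x \<in> space (lebJ {1..n})" for x
        using that by (auto simp: space_lebJ PiE_iff extensional_def)
      then show ?thesis by (subst measurable_cong[where g="\<lambda>_. undefined"]) auto
    qed
  qed auto
  then have m: "(\<lambda>x. x) \<in> measurable (lebJ {1..n}) (borel :: (nat \<Rightarrow> real) measure)"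
    using measurable_cong_sets[OF refl sets_PiM_equal_borel] by blast
  have "K \<in> sets borel" using K by (intro borel_closed compact_imp_closed)
  from measurable_sets[OF m this] show "K \<in> sets (lebJ {1..n})"
    using sub by (simp add: space_lebJ Int_absorb2)
  have "\<exists>R. \<forall>x\<in>K. \<bar>x j\<bar> \<le> R" for j
  proof -
    have "compact ((\<lambda>x. x j) ` K)"
      using K(2) by (intro compact_continuous_image continuous_on_product_coordinates continuous_on_subset[OF continuous_on_product_coordinates]) auto
    then have "bounded ((\<lambda>x. x j) ` K)" by (rule compact_imp_bounded)
    then show ?thesis by (auto simp: bounded_iff)
  qed
  then obtain R where R: "\<And>j x. x \<in> K \<Longrightarrow> \<bar>x j\<bar> \<le> R j" by metis
  have "\<bar>x j\<bar> \<le> (\<Sum>j\<in>{1..n}. \<bar>R j\<bar>)" if "x \<in> K" "j \<in> {1..n}" for x j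
  proof -
    have "\<bar>x j\<bar> \<le> \<bar>R j\<bar>" using R[OF that(1), of j] by linarith
    also have "\<dots> \<le> (\<Sum>j\<in>{1..n}. \<bar>R j\<bar>)" using that by (intro member_le_sum) auto
    finally show ?thesis .
  qed
  then show "\<exists>R. \<forall>x\<in>K. \<forall>j\<in>{1..n}. \<bar>x j\<bar> \<le> R" by blast
qed

lemma convex_body_convex:
  assumes "convex_body n K" "x \<in> K" "y \<in> K" "0 \<le> t" "t \<le> 1"
  shows "(\<lambda>i\<in>{1..n}. (1 - t) * x i + t * y i) \<in> K"
  using assms unfolding convex_body_def by blast

text \<open>The marginal density of \<open>K\<close> on the coordinates in \<open>\<sigma>\<close>.
  It is written as the integral of an indicator for use with Fubini's theorem, and defined for every
  function \<open>y\<close> so that \<open>log_concave\<close> applies to it.\<close>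

definition sect :: "nat \<Rightarrow> (nat \<Rightarrow> real) set \<Rightarrow> nat set \<Rightarrow> (nat \<Rightarrow> real) \<Rightarrow> real" where
  "sect n K \<sigma> y = (\<integral>w. indicator K (\<lambda>i\<in>{1..n}. if i \<in> \<sigma> then y i else w i) \<partial>lebJ ({1..n} - \<sigma>))"

lemma tame_fibre:
  assumes K: "convex_body n K" and \<sigma>: "\<sigma> \<subseteq> {1..n}"
  shows "tame ({1..n} - \<sigma>) (\<lambda>w. indicator K (\<lambda>i\<in>{1..n}. if i \<in> \<sigma> then y i else w i))"
proof -
  obtain R where R: "\<And>x j. x \<in> K \<Longrightarrow> j \<in> {1..n} \<Longrightarrow> \<bar>x j\<bar> \<le> R"
    using convex_bodyD(2)[OF K] by blast
  show ?thesis
  proof (rule tameI[where M=1 and R=R])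
    have "(\<lambda>w. \<lambda>i\<in>{1..n}. if i \<in> \<sigma> then y i else w i) \<in> measurable (lebJ ({1..n} - \<sigma>)) (lebJ {1..n})"
    proof (rule measurable_restrict)
      fix i assume "i \<in> {1..n}"
      then show "(\<lambda>w. if i \<in> \<sigma> then y i else w i) \<in> measurable (lebJ ({1..n} - \<sigma>)) lborel"
        using measurable_component_singleton[of i "{1..n} - \<sigma>" "\<lambda>_. lborel :: real measure"] by (cases "i \<in> \<sigma>") auto
    qed
    from measurable_compose[OF this borel_measurable_indicator[OF convex_bodyD(1)[OF K]]]
    show "(\<lambda>w. indicator K (\<lambda>i\<in>{1..n}. if i \<in> \<sigma> then y i else w i) :: real) \<in> borel_measurable (lebJ ({1..n} - \<sigma>))" .
  next
    fix w j assume "indicator K (\<lambda>i\<in>{1..n}. if i \<in> \<sigma> then y i else w i) \<noteq> (0::real)" "j \<in> {1..n} - \<sigma>"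
    then show "\<bar>w j\<bar> \<le> R" using R[of "\<lambda>i\<in>{1..n}. if i \<in> \<sigma> then y i else w i" j]
      by (auto simp: indicator_def split: if_splits)
  qed (auto simp: indicator_def)
qed

text \<open>Brunn's principle in log-concave form. With two functions on the full fibre space, the
  reverse Brascamp-Lieb inequality becomes the Prekopa-Leindler inequality, used here for the
  indicators of two slices.\<close>

lemma sect_log_concave:
  assumes K: "convex_body n K" and \<sigma>: "\<sigma> \<subseteq> {1..n}"
  shows "log_concave (sect n K \<sigma>)"
  unfolding log_concave_def
proof (intro conjI allI impI)
  show "0 \<le> sect n K \<sigma> x" for x unfolding sect_def by (intro Bochner_Integration.integral_nonneg) auto
  fix x y :: "nat \<Rightarrow> real" and \<theta> :: real assume \<theta>: "0 < \<theta>" "\<theta> < 1"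
  let ?T = "{1..n} - \<sigma>"
  \<comment> \<open>The two slices are indexed by \<open>bool\<close>: \<open>False\<close> stands
    for \<open>x\<close> and \<open>True\<close> for \<open>y\<close>.\<close>
  define c where "c b = (if b then \<theta> else 1 - \<theta>)" for b
  define p where "p b = (if b then y else x)" for b
  define G where "G z w = (indicator K (\<lambda>i\<in>{1..n}. if i \<in> \<sigma> then z i else w i) :: real)" for z w
  let ?z = "\<lambda>j. (1 - \<theta>) * x j + \<theta> * y j"
  have "(\<Prod>b\<in>UNIV. (\<integral>w. G (p b) w \<partial>lebJ ?T) powr c b) \<le> (\<integral>w. G ?z w \<partial>lebJ ?T)"
  proof (rule coordinate_reverse_brascamp_lieb)
    show "(\<Sum>b\<in>{b\<in>UNIV. j \<in> ?T}. c b) = 1" if "j \<in> ?T" for j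
      using that by (simp add: c_def UNIV_bool)
    show "tame ?T (G (p b))" for b unfolding G_def by (rule tame_fibre[OF K \<sigma>])
    show "tame ?T (G ?z)" unfolding G_def by (rule tame_fibre[OF K \<sigma>])
    fix w :: "bool \<Rightarrow> nat \<Rightarrow> real"
    let ?W = "\<lambda>j\<in>?T. \<Sum>b\<in>{b\<in>UNIV. j \<in> ?T}. c b * w b j"
    let ?a = "\<lambda>i\<in>{1..n}. if i \<in> \<sigma> then x i else w False i" and ?b = "\<lambda>i\<in>{1..n}. if i \<in> \<sigma> then y i else w True i"
    show "(\<Prod>b\<in>UNIV. G (p b) (w b) powr c b) \<le> G ?z ?W"
    proof (cases "?a \<in> K \<and> ?b \<in> K")
      case True
      then have "(\<lambda>i\<in>{1..n}. (1 - \<theta>) * ?a i + \<theta> * ?b i) \<in> K"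
        using convex_body_convex[OF K, of ?a ?b \<theta>] \<theta> by simp
      also have "(\<lambda>i\<in>{1..n}. (1 - \<theta>) * ?a i + \<theta> * ?b i) = (\<lambda>i\<in>{1..n}. if i \<in> \<sigma> then ?z i else ?W i)"
        by (auto simp: fun_eq_iff c_def UNIV_bool)
      finally have "G ?z ?W = 1" unfolding G_def by (rule indicator_simps(1))
      moreover have "(\<Prod>b\<in>UNIV. G (p b) (w b) powr c b) = 1"
        using True by (simp add: UNIV_bool G_def p_def)
      ultimately show ?thesis by simp
    next
      case False
      then have "(\<Prod>b\<in>UNIV. G (p b) (w b) powr c b) = 0"
        by (auto simp: UNIV_bool G_def p_def)
      moreover have "0 \<le> G ?z ?W" unfolding G_def by simp
      ultimately show ?thesis by linarith
    qed
  qed (use \<theta> in \<open>auto simp: c_def\<close>)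
  moreover have "(\<integral>w. G z w \<partial>lebJ ?T) = sect n K \<sigma> z" for z by (simp only: G_def sect_def)
  ultimately show "sect n K \<sigma> x powr (1 - \<theta>) * sect n K \<sigma> y powr \<theta> \<le> sect n K \<sigma> ?z"
    by (simp add: UNIV_bool c_def p_def)
qed

lemma sect_restrict: "sect n K \<sigma> (restrict y \<sigma>) = sect n K \<sigma> y"
  by (simp add: sect_def cong: if_cong)

lemma sect_cong: "(\<And>i. i \<in> \<sigma> \<Longrightarrow> x i = y i) \<Longrightarrow> sect n K \<sigma> x = sect n K \<sigma> y"
  by (metis restrict_ext sect_restrict)

text \<open>Fubini's theorem on the coordinates outside \<open>\<tau>\<close>, integrating first
  those outside \<open>\<sigma>\<close>. The case \<open>\<tau> = {}\<close> yields the volume of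
  \<open>K\<close>, \<open>\<tau> = \<sigma>\<close> the value of the section function at 0, and the
  members of the cover yield their sections.\<close>

lemma sect_fold:
  assumes K: "convex_body n K" and \<sigma>: "\<sigma> \<subseteq> {1..n}" and \<tau>: "\<tau> \<subseteq> \<sigma>"
  defines "F \<equiv> \<lambda>y. sect n K \<sigma> (\<lambda>i. if i \<in> \<sigma> - \<tau> then y i else 0)"
  shows "tame (\<sigma> - \<tau>) F" and "sec_vol n K \<tau> = (\<integral>y. F y \<partial>lebJ (\<sigma> - \<tau>))"
proof -
  define g where "g w = (indicator K (\<lambda>i\<in>{1..n}. if i \<in> \<tau> then 0 else w i) :: real)" for w
  have fin: "finite (\<sigma> - \<tau>)" "finite ({1..n} - \<sigma>)" "(\<sigma> - \<tau>) \<inter> ({1..n} - \<sigma>) = {}"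
    using \<sigma> finite_subset[OF \<sigma>] by auto
  have un: "(\<sigma> - \<tau>) \<union> ({1..n} - \<sigma>) = {1..n} - \<tau>" using \<sigma> \<tau> by auto
  have tg: "tame ({1..n} - \<tau>) g"
    unfolding g_def using tame_fibre[OF K, of \<tau> "\<lambda>_. 0"] \<sigma> \<tau> by auto
  have F: "F y = (\<integral>w. g (merge (\<sigma> - \<tau>) ({1..n} - \<sigma>) (y, w)) \<partial>lebJ ({1..n} - \<sigma>))" for y
  proof -
    have "(\<lambda>i\<in>{1..n}. if i \<in> \<sigma> then if i \<in> \<sigma> - \<tau> then y i else 0 else w i) =
      (\<lambda>i\<in>{1..n}. if i \<in> \<tau> then 0 else merge (\<sigma> - \<tau>) ({1..n} - \<sigma>) (y, w) i)" for w
      using \<tau> by (auto simp: fun_eq_iff merge_def)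
    then show ?thesis unfolding F_def sect_def g_def by presburger
  qed
  show "tame (\<sigma> - \<tau>) F" unfolding F by (rule tame_merge[OF fin]) (simp only: un tg)
  define S where "S = (\<lambda>x. restrict x ({1..n} - \<tau>)) ` (K \<inter> E n \<tau>)"
  \<comment> \<open>Extension by 0 on \<open>\<tau>\<close> identifies \<open>S\<close> with the
    section, so the measure in \<open>sec_vol\<close> is the integral of \<open>g\<close>.\<close>
  have gS: "g w = indicator S w" if w: "w \<in> space (lebJ ({1..n} - \<tau>))" for w
  proof -
    let ?z = "\<lambda>i\<in>{1..n}. if i \<in> \<tau> then 0 else w i"
    have "w \<in> S \<longleftrightarrow> ?z \<in> K"
    proof
      assume "w \<in> S"
      then obtain x where x: "x \<in> K" "x \<in> E n \<tau>" "w = restrict x ({1..n} - \<tau>)" by (auto simp: S_def)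
      have "?z = x" using x(2) \<tau> \<sigma> by (auto simp: x(3) fun_eq_iff E_def Rn_def PiE_iff extensional_def)
      then show "?z \<in> K" using x by simp
    next
      assume z: "?z \<in> K"
      have "?z \<in> E n \<tau>" using \<tau> \<sigma> by (auto simp: E_def Rn_def)
      moreover have "w = restrict ?z ({1..n} - \<tau>)"
        using w by (auto simp: space_lebJ fun_eq_iff PiE_iff extensional_def)
      ultimately show "w \<in> S" using z unfolding S_def by blast
    qed
    then show ?thesis by (simp add: g_def indicator_def)
  qed
  have Ssub: "S \<subseteq> space (lebJ ({1..n} - \<tau>))" by (auto simp: S_def space_lebJ split: if_splits)
  have "(\<integral>w. g w \<partial>lebJ ({1..n} - \<tau>)) = (\<integral>w. indicator S w \<partial>lebJ ({1..n} - \<tau>))"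
    by (intro Bochner_Integration.integral_cong refl gS)
  also have "\<dots> = measure (lebJ ({1..n} - \<tau>)) S" using Ssub by (simp add: Int_absorb2)
  finally have "sec_vol n K \<tau> = (\<integral>w. g w \<partial>lebJ ({1..n} - \<tau>))"
    by (simp add: sec_vol_def S_def)
  also have "\<dots> = (\<integral>w. g w \<partial>lebJ ((\<sigma> - \<tau>) \<union> ({1..n} - \<sigma>)))" by (simp only: un)
  also have "\<dots> = (\<integral>y. F y \<partial>lebJ (\<sigma> - \<tau>))"
    unfolding F by (rule lebJ.product_integral_fold[OF fin(3,1,2)]) (unfold un, rule tame_integrable[OF _ tg], simp)
  finally show "sec_vol n K \<tau> = (\<integral>y. F y \<partial>lebJ (\<sigma> - \<tau>))" .
qed

lemma sec_vol_empty:
  assumes "convex_body n K"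
  shows "sec_vol n K {} = vol n K"
proof -
  have "restrict x {1..n} = x" if "x \<in> K" for x
    using convex_bodyD(3)[OF assms] that by (auto intro: PiE_restrict)
  moreover have "K \<inter> E n {} = K" using assms by (auto simp: E_def convex_body_def)
  ultimately show ?thesis by (simp add: sec_vol_def vol_def)
qed

text \<open>The slice over \<open>y\<close> contains a box of half-width \<open>e / 2\<close> in the
  remaining coordinates. With \<open>\<sigma> = {}\<close> this also gives a positive volume of
  \<open>K\<close>.\<close>

lemma sect_pos:
  assumes K: "convex_body n K" and \<sigma>: "\<sigma> \<subseteq> {1..n}" and e: "e > 0"
    and nbhd: "\<And>x. (\<And>i. i \<in> {1..n} \<Longrightarrow> \<bar>x i\<bar> < e) \<Longrightarrow> restrict x {1..n} \<in> K"
    and y: "\<And>j. j \<in> \<sigma> \<Longrightarrow> \<bar>y j\<bar> < e"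
  shows "sect n K \<sigma> y > 0"
proof -
  let ?T = "{1..n} - \<sigma>"
  let ?B = "PiE ?T (\<lambda>j. {-(e/2)..e/2})"
  have "0 < (\<Prod>j\<in>?T. e/2 - -(e/2))" using e by (intro prod_pos) auto
  also have "\<dots> = measure (lebJ ?T) ?B" using e by (intro box_measure[symmetric]) auto
  also have "\<dots> = (\<integral>w. indicator ?B w \<partial>lebJ ?T)"
    using box_fmeasurable[of ?T "\<lambda>_. -(e/2)" "\<lambda>_. e/2"] by (simp add: fmeasurable_def)
  also have "\<dots> \<le> sect n K \<sigma> y"
    unfolding sect_def
  proof (rule integral_mono)
    show "integrable (lebJ ?T) (indicator ?B :: _ \<Rightarrow> real)"
      using box_fmeasurable[of ?T "\<lambda>_. -(e/2)" "\<lambda>_. e/2"]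
      by (intro integrable_real_indicator) (auto simp: fmeasurable_def)
    show "integrable (lebJ ?T) (\<lambda>w. indicator K (\<lambda>i\<in>{1..n}. if i \<in> \<sigma> then y i else w i) :: real)"
      by (rule tame_integrable[OF _ tame_fibre[OF K \<sigma>]]) simp
    fix w
    have "(\<lambda>i\<in>{1..n}. if i \<in> \<sigma> then y i else w i) \<in> K" if w: "w \<in> ?B"
    proof (rule nbhd)
      fix i assume i: "i \<in> {1..n}"
      have "\<bar>w i\<bar> < e" if "i \<notin> \<sigma>"
      proof -
        have "w i \<in> {-(e/2)..e/2}" using PiE_mem[OF w, of i] i that by simp
        then show ?thesis using e by auto
      qed
      then show "\<bar>if i \<in> \<sigma> then y i else w i\<bar> < e" using y[of i] by auto
    qed
    then show "indicator ?B w \<le> (indicator K (\<lambda>i\<in>{1..n}. if i \<in> \<sigma> then y i else w i) :: real)"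
      by (cases "w \<in> ?B") simp_all
  qed
  finally show ?thesis .
qed

lemma tame_body:
  assumes K: "convex_body n K"
  shows "tame {1..n} (indicator K)"
proof -
  obtain R where R: "\<And>x j. x \<in> K \<Longrightarrow> j \<in> {1..n} \<Longrightarrow> \<bar>x j\<bar> \<le> R"
    using convex_bodyD(2)[OF K] by blast
  show ?thesis
  proof (rule tameI[where M=1 and R=R])
    show "indicat_real K \<in> borel_measurable (lebJ {1..n})"
      using convex_bodyD(1)[OF K] by (rule borel_measurable_indicator)
    show "\<bar>x j\<bar> \<le> R" if "indicator K x \<noteq> (0::real)" "j \<in> {1..n}" for x j
      using that by (intro R) (simp_all add: indicator_eq_0_iff)
  qed (simp_all add: indicator_def)
qed

text \<open>Transfers the centering of \<open>K\<close> to the section function: by Fubini's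
  theorem, since coordinate \<open>j\<close> is constant on each fibre.\<close>

lemma coord_integral:
  assumes K: "convex_body n K" and \<sigma>: "\<sigma> \<subseteq> {1..n}" and j: "j \<in> \<sigma>"
  shows "(\<integral>y. y j * sect n K \<sigma> y \<partial>lebJ \<sigma>) = set_lebesgue_integral (lebJ {1..n}) K (\<lambda>x. x j)"
proof -
  let ?T = "{1..n} - \<sigma>"
  have fin: "finite \<sigma>" "finite ?T" "\<sigma> \<inter> ?T = {}" using finite_subset[OF \<sigma>] by auto
  have un: "\<sigma> \<union> ?T = {1..n}" using \<sigma> by auto
  have "set_lebesgue_integral (lebJ {1..n}) K (\<lambda>x. x j) = (\<integral>x. x j * indicator K x \<partial>lebJ (\<sigma> \<union> ?T))"
    unfolding set_lebesgue_integral_def un by (simp add: mult.commute)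
  also have "\<dots> = (\<integral>y. (\<integral>w. merge \<sigma> ?T (y, w) j * indicator K (merge \<sigma> ?T (y, w)) \<partial>lebJ ?T) \<partial>lebJ \<sigma>)"
    using \<sigma> j by (intro lebJ.product_integral_fold[OF fin(3,1,2)], unfold un, intro tame_coord_integrable[OF _ tame_body[OF K]]) auto
  also have "\<dots> = (\<integral>y. y j * sect n K \<sigma> y \<partial>lebJ \<sigma>)"
  proof (intro Bochner_Integration.integral_cong refl)
    fix y :: "nat \<Rightarrow> real"
    have eq: "merge \<sigma> ?T (y, w) = (\<lambda>i\<in>{1..n}. if i \<in> \<sigma> then y i else w i)" for w
      using \<sigma> by (auto simp: fun_eq_iff merge_def)
    show "(\<integral>w. merge \<sigma> ?T (y, w) j * indicator K (merge \<sigma> ?T (y, w)) \<partial>lebJ ?T) = y j * sect n K \<sigma> y"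
      using j \<sigma> unfolding eq sect_def by auto
  qed
  finally show ?thesis by simp
qed

section \<open>The centroid as an interior point\<close>

text \<open>Let \<open>K\<close> contain a box around \<open>a\<close>. If the origin is a convex
  combination of \<open>a\<close> and a point of \<open>K\<close> with positive weight on
  \<open>a\<close>, a shrunken box lies around it. Otherwise a linear functional would be
  nonnegative on \<open>K\<close> and positive near \<open>a\<close>, contradicting its zero
  mean.\<close>

lemma centroid_interior:
  assumes "centered_convex_body n K"
  shows "\<exists>e>0. \<forall>x. (\<forall>i\<in>{1..n}. \<bar>x i\<bar> < e) \<longrightarrow> restrict x {1..n} \<in> K"
proof -
  let ?N = "{1..n}"
  have K: "convex_body n K" and cent: "\<And>i. i \<in> ?N \<Longrightarrow> set_lebesgue_integral (lebJ ?N) K (\<lambda>x. x i) = 0"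
    using assms unfolding centered_convex_body_def by blast+
  have "\<exists>x\<in>K. \<exists>e>0. \<forall>y\<in>Rn n. (\<forall>i\<in>?N. \<bar>y i - x i\<bar> < e) \<longrightarrow> y \<in> K"
    using K unfolding convex_body_def by (elim conjE)
  then obtain a e where a: "a \<in> K" and e: "e > 0" and ae: "\<And>y. y \<in> Rn n \<Longrightarrow> (\<And>i. i \<in> ?N \<Longrightarrow> \<bar>y i - a i\<bar> < e) \<Longrightarrow> y \<in> K"
    by blast
  have box: "restrict y ?N \<in> K" if "\<And>i. i \<in> ?N \<Longrightarrow> \<bar>y i - a i\<bar> < e" for y
    using that by (intro ae) (auto simp: Rn_def)
  have "\<exists>\<rho> z. 0 \<le> \<rho> \<and> \<rho> < 1 \<and> z \<in> K \<and> (\<forall>i\<in>?N. 0 = (1 - \<rho>) * a i + \<rho> * z i)"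
  proof (rule ccontr)
    assume no: "\<not> ?thesis"
    \<comment> \<open>The graph of minus the gauge of \<open>K\<close> about \<open>a\<close>, together with the points below it: the hyperplane
      supporting it at \<open>0\<close> yields a functional that is nonnegative on \<open>K\<close>, positive near \<open>a\<close>, and
      has mean zero on \<open>K\<close>.\<close>
    define A where "A = {(x, t). \<exists>z\<in>K. \<exists>\<rho>\<ge>0. t = - \<rho> \<and> (\<forall>i\<in>?N. x i = (1 - \<rho>) * a i + \<rho> * z i)}"
    have AI: "(x, - \<rho>) \<in> A" if "z \<in> K" "\<rho> \<ge> 0" "\<And>i. i \<in> ?N \<Longrightarrow> x i = (1 - \<rho>) * a i + \<rho> * z i" for x z \<rho>
      using that unfolding A_def by blast
    have all: "\<exists>t. (x, t) \<in> A" for x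
    proof -
      \<comment> \<open>Chosen so that every coordinate of \<open>(x - a) / \<rho>\<close> is
        smaller than \<open>e\<close>; the summand 1 makes this strict and keeps
        \<open>\<rho>\<close> positive.\<close>
      define \<rho> where "\<rho> = ((\<Sum>i\<in>?N. \<bar>x i - a i\<bar>) + 1) / e"
      have s: "(\<Sum>i\<in>?N. \<bar>x i - a i\<bar>) \<ge> 0" by (intro sum_nonneg) auto
      then have \<rho>: "\<rho> > 0" unfolding \<rho>_def using e by (intro divide_pos_pos add_nonneg_pos) auto
      let ?z = "\<lambda>i. a i + (x i - a i) / \<rho>"
      have "(x, - \<rho>) \<in> A"
      proof (rule AI)
        show "restrict ?z ?N \<in> K"
        proof (rule box)
          fix i assume i: "i \<in> ?N"
          have "\<bar>x i - a i\<bar> \<le> (\<Sum>i\<in>?N. \<bar>x i - a i\<bar>)" using i by (intro member_le_sum) auto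
          then have "\<bar>x i - a i\<bar> < e * \<rho>" using e by (simp add: \<rho>_def)
          then show "\<bar>?z i - a i\<bar> < e" using \<rho> by (simp add: field_simps)
        qed
        show "x i = (1 - \<rho>) * a i + \<rho> * restrict ?z ?N i" if "i \<in> ?N" for i
          using that \<rho> by (simp add: field_simps)
      qed (use \<rho> in simp)
      then show ?thesis by blast
    qed
    \<comment> \<open>The height \<open>-1\<close> at the origin comes from the denial of the claim:
      every representation of the origin has \<open>\<rho> \<ge> 1\<close>.\<close>
    have "\<exists>u. \<forall>x t. (x, t) \<in> A \<longrightarrow> (\<forall>j. j \<notin> ?N \<longrightarrow> x j = 0) \<longrightarrow> t \<le> -1 + (\<Sum>j\<in>?N. u j * x j)"
    proof (rule supporting_hyperplane)
      show "finite ?N" by simp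
      fix x t y s and \<theta> :: real
      assume A: "(x, t) \<in> A" "(y, s) \<in> A" and \<theta>: "0 < \<theta>" "\<theta> < 1"
      obtain z \<rho> where z: "z \<in> K" "\<rho> \<ge> 0" "t = -\<rho>" "\<And>i. i \<in> ?N \<Longrightarrow> x i = (1 - \<rho>) * a i + \<rho> * z i"
        using A(1) unfolding A_def by blast
      obtain w \<mu> where w: "w \<in> K" "\<mu> \<ge> 0" "s = -\<mu>" "\<And>i. i \<in> ?N \<Longrightarrow> y i = (1 - \<mu>) * a i + \<mu> * w i"
        using A(2) unfolding A_def by blast
      define \<nu> where "\<nu> = (1 - \<theta>) * \<rho> + \<theta> * \<mu>"
      have eq: "(1 - \<theta>) * t + \<theta> * s = - \<nu>" by (simp add: \<nu>_def z w algebra_simps)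
      have \<nu>: "\<nu> \<ge> 0" "(1 - \<theta>) * \<rho> \<ge> 0" "\<theta> * \<mu> \<ge> 0" using z w \<theta> by (auto simp: \<nu>_def)
      show "((\<lambda>j. (1 - \<theta>) * x j + \<theta> * y j), (1 - \<theta>) * t + \<theta> * s) \<in> A"
        unfolding eq
      proof (cases "\<nu> = 0")
        case True
        then have "(1 - \<theta>) * \<rho> = 0" "\<theta> * \<mu> = 0" using \<nu> unfolding \<nu>_def by linarith+
        then have "\<rho> = 0" "\<mu> = 0" using \<theta> by auto
        then show "((\<lambda>j. (1 - \<theta>) * x j + \<theta> * y j), - \<nu>) \<in> A"
          using True z w by (intro AI[of z]) (auto simp: algebra_simps)
      next
        case False
        with \<nu> have \<nu>p: "\<nu> > 0" by simp
        \<comment> \<open>The combined displacement from \<open>a\<close> is \<open>(1 - \<theta>) *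
          \<rho> * (z - a) + \<theta> * \<mu> * (w - a)\<close>, and \<open>\<kappa>\<close> is the
          share of \<open>w\<close> in it. In the excluded case \<open>\<nu> = 0\<close> both points
          agree with \<open>a\<close> on \<open>?N\<close>.\<close>
        define \<kappa> where "\<kappa> = \<theta> * \<mu> / \<nu>"
        have \<kappa>: "0 \<le> \<kappa>" "\<kappa> \<le> 1" using \<nu> \<nu>p by (auto simp: \<kappa>_def \<nu>_def)
        have k2: "\<nu> * \<kappa> = \<theta> * \<mu>" using \<nu>p by (simp add: \<kappa>_def)
        have k1: "\<nu> * (1 - \<kappa>) = (1 - \<theta>) * \<rho>" using k2 by (simp add: right_diff_distrib \<nu>_def)
        show "((\<lambda>j. (1 - \<theta>) * x j + \<theta> * y j), - \<nu>) \<in> A"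
        proof (rule AI[OF convex_body_convex[OF K z(1) w(1) \<kappa>] \<nu>(1)])
          fix i assume i: "i \<in> ?N"
          have "\<nu> * ((1 - \<kappa>) * z i + \<kappa> * w i) = (\<nu> * (1 - \<kappa>)) * z i + (\<nu> * \<kappa>) * w i"
            by (simp add: algebra_simps)
          also have "\<dots> = (1 - \<theta>) * \<rho> * z i + \<theta> * \<mu> * w i" unfolding k1 k2 ..
          finally have "\<nu> * (\<lambda>i\<in>?N. (1 - \<kappa>) * z i + \<kappa> * w i) i = (1 - \<theta>) * \<rho> * z i + \<theta> * \<mu> * w i"
            using i by simp
          then show "(1 - \<theta>) * x i + \<theta> * y i = (1 - \<nu>) * a i + \<nu> * (\<lambda>i\<in>?N. (1 - \<kappa>) * z i + \<kappa> * w i) i"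
            unfolding z(4)[OF i] w(4)[OF i] by (simp add: \<nu>_def algebra_simps)
        qed
      qed
    next
      fix t assume "((\<lambda>_. 0), t) \<in> A"
      then obtain z \<rho> where "z \<in> K" "\<rho> \<ge> 0" "t = -\<rho>" "\<forall>i\<in>?N. 0 = (1 - \<rho>) * a i + \<rho> * z i"
        unfolding A_def by blast
      then show "t \<le> -1" using no by force
    next
      fix j
      show "\<exists>e>0. \<exists>t. ((\<lambda>_. 0)(j := e), t) \<in> A" using all zero_less_one by blast
      show "\<exists>e>0. \<exists>t. ((\<lambda>_. 0)(j := - e), t) \<in> A" using all zero_less_one by blast
    qed
    then obtain u where u: "\<And>x t. (x, t) \<in> A \<Longrightarrow> (\<forall>j. j \<notin> ?N \<longrightarrow> x j = 0) \<Longrightarrow> t \<le> -1 + (\<Sum>j\<in>?N. u j * x j)"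
      by blast
    define \<phi> where "\<phi> x = (\<Sum>j\<in>?N. u j * x j)" for x
    \<comment> \<open>A point of \<open>K\<close> lies in \<open>A\<close> at height
      \<open>-1\<close> (take \<open>\<rho> = 1\<close>), and \<open>a\<close> at height 0 (take
      \<open>\<rho> = 0\<close>).\<close>
    have \<phi>K: "\<phi> z \<ge> 0" if "z \<in> K" for z
    proof -
      let ?x = "\<lambda>j. if j \<in> ?N then z j else 0"
      have "-1 \<le> -1 + (\<Sum>j\<in>?N. u j * ?x j)"
        by (intro u AI[OF that]) auto
      also have "(\<Sum>j\<in>?N. u j * ?x j) = \<phi> z" by (simp add: \<phi>_def)
      finally show ?thesis by simp
    qed
    have \<phi>a: "\<phi> a \<ge> 1"
    proof -
      let ?x = "\<lambda>j. if j \<in> ?N then a j else 0"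
      have "(?x, - 0) \<in> A" by (rule AI[OF a]) auto
      then have "- 0 \<le> -1 + (\<Sum>j\<in>?N. u j * ?x j)"
        by (intro u) auto
      also have "(\<Sum>j\<in>?N. u j * ?x j) = \<phi> a" by (simp add: \<phi>_def)
      finally show ?thesis by simp
    qed
    define U where "U = (\<Sum>j\<in>?N. \<bar>u j\<bar>)"
    have U: "U \<ge> 0" by (simp add: U_def sum_nonneg)
    \<comment> \<open>Small enough that the box around \<open>a\<close> stays in \<open>K\<close>
      and \<open>\<phi>\<close> drops by at most 1/2 on it; \<open>1 + U\<close> guards against
      \<open>U = 0\<close>.\<close>
    define \<delta> where "\<delta> = min (e/2) (1 / (2 * (1 + U)))"
    have \<delta>: "\<delta> > 0" "\<delta> < e" using e U by (auto simp: \<delta>_def)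
    have \<delta>U: "\<delta> * U \<le> 1/2"
    proof -
      have "\<delta> * U \<le> 1 / (2 * (1 + U)) * U" using U by (intro mult_right_mono) (auto simp: \<delta>_def)
      also have "\<dots> \<le> 1/2" using U by (simp add: field_simps)
      finally show ?thesis .
    qed
    let ?B = "PiE ?N (\<lambda>j. {a j - \<delta>..a j + \<delta>})"
    have B: "x \<in> K" "\<phi> x \<ge> 1/2" if x: "x \<in> ?B" for x
    proof -
      have xi: "\<bar>x i - a i\<bar> \<le> \<delta>" if "i \<in> ?N" for i
        using PiE_mem[OF x that] by (auto simp: abs_le_iff)
      have "restrict x ?N \<in> K" using xi \<delta>(2) by (intro box) (meson le_less_trans)
      then show "x \<in> K" using x by (simp add: PiE_restrict)
      have "\<phi> a - \<phi> x = (\<Sum>j\<in>?N. u j * (a j - x j))"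
        by (simp add: \<phi>_def sum_subtractf algebra_simps)
      also have "\<dots> \<le> (\<Sum>j\<in>?N. \<bar>u j\<bar> * \<delta>)"
      proof (rule sum_mono)
        fix j assume "j \<in> ?N"
        have "u j * (a j - x j) \<le> \<bar>u j * (a j - x j)\<bar>" by simp
        also have "\<dots> \<le> \<bar>u j\<bar> * \<delta>"
          unfolding abs_mult using xi[OF \<open>j \<in> ?N\<close>] by (intro mult_left_mono) (auto simp: abs_minus_commute)
        finally show "u j * (a j - x j) \<le> \<bar>u j\<bar> * \<delta>" .
      qed
      also have "\<dots> = \<delta> * U" by (simp add: U_def sum_distrib_left mult.commute)
      finally show "\<phi> x \<ge> 1/2" using \<delta>U \<phi>a by linarith
    qed
    have set_int: "set_integrable (lebJ ?N) K (\<lambda>x. x j)" if j: "j \<in> ?N" for j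
      using tame_coord_integrable[OF _ tame_body[OF K] j]
      by (simp add: set_integrable_def mult.commute)
    \<comment> \<open>The integral of \<open>\<phi>\<close> over \<open>K\<close> is at least half
      the volume of the box, yet every coordinate integral is 0.\<close>
    have "0 < 1/2 * (\<Prod>j\<in>?N. a j + \<delta> - (a j - \<delta>))" using \<delta> by (intro mult_pos_pos prod_pos) auto
    also have "(\<Prod>j\<in>?N. a j + \<delta> - (a j - \<delta>)) = measure (lebJ ?N) ?B"
      using \<delta> by (intro box_measure[symmetric]) auto
    also have "1/2 * measure (lebJ ?N) ?B = (\<integral>x. 1/2 * indicator ?B x \<partial>lebJ ?N)"
      using box_fmeasurable[of ?N "\<lambda>j. a j - \<delta>" "\<lambda>j. a j + \<delta>"] by (simp add: fmeasurable_def)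
    also have "\<dots> \<le> (\<integral>x. (\<Sum>j\<in>?N. u j * (indicator K x *\<^sub>R x j)) \<partial>lebJ ?N)"
    proof (rule integral_mono)
      show "integrable (lebJ ?N) (\<lambda>x. 1/2 * indicator ?B x :: real)"
        using box_fmeasurable[of ?N "\<lambda>j. a j - \<delta>" "\<lambda>j. a j + \<delta>"]
        by (intro integrable_mult_right integrable_real_indicator) (auto simp: fmeasurable_def)
      show "integrable (lebJ ?N) (\<lambda>x. \<Sum>j\<in>?N. u j * (indicator K x *\<^sub>R x j))"
        using set_int unfolding set_integrable_def
        by (intro Bochner_Integration.integrable_sum integrable_mult_right) auto
      fix x
      have "(\<Sum>j\<in>?N. u j * (indicator K x *\<^sub>R x j)) = indicator K x * \<phi> x"
        by (simp add: \<phi>_def sum_distrib_left mult.left_commute)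
      then show "1/2 * indicator ?B x \<le> (\<Sum>j\<in>?N. u j * (indicator K x *\<^sub>R x j))"
        using B[of x] \<phi>K[of x] by (cases "x \<in> ?B"; cases "x \<in> K") auto
    qed
    also have "\<dots> = (\<Sum>j\<in>?N. u j * set_lebesgue_integral (lebJ ?N) K (\<lambda>x. x j))"
      unfolding set_lebesgue_integral_def using set_int unfolding set_integrable_def
      by (subst Bochner_Integration.integral_sum) auto
    also have "\<dots> = 0" using cent by simp
    finally show False by simp
  qed
  then obtain \<rho> z where \<rho>: "0 \<le> \<rho>" "\<rho> < 1" and z: "z \<in> K" "\<And>i. i \<in> ?N \<Longrightarrow> 0 = (1 - \<rho>) * a i + \<rho> * z i"
    by blast
  \<comment> \<open>The box around \<open>a\<close> is shrunk towards \<open>z\<close> with ratio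
    \<open>1 - \<rho>\<close>, which moves its centre to the origin.\<close>
  have "restrict x ?N \<in> K" if x: "\<forall>i\<in>?N. \<bar>x i\<bar> < (1 - \<rho>) * e" for x
  proof -
    define y where "y i = a i + x i / (1 - \<rho>)" for i
    have "restrict y ?N \<in> K"
    proof (rule box)
      fix i assume "i \<in> ?N"
      then show "\<bar>y i - a i\<bar> < e" using x \<rho> by (simp add: y_def field_simps)
    qed
    from convex_body_convex[OF K this z(1), of \<rho>] \<rho>
    have "(\<lambda>i\<in>?N. (1 - \<rho>) * restrict y ?N i + \<rho> * z i) \<in> K" by simp
    also have "(\<lambda>i\<in>?N. (1 - \<rho>) * restrict y ?N i + \<rho> * z i) = restrict x ?N"
    proof (rule restrict_ext)
      fix i assume i: "i \<in> ?N"
      have "(1 - \<rho>) * y i = (1 - \<rho>) * a i + x i" using \<rho> by (simp add: y_def field_simps)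
      then show "(1 - \<rho>) * restrict y ?N i + \<rho> * z i = x i" using z(2)[OF i] i by simp
    qed
    finally show ?thesis .
  qed
  moreover have "(1 - \<rho>) * e > 0" using \<rho> e by simp
  ultimately show ?thesis by blast
qed

section \<open>Assembly of the estimate for uniform covers\<close>

lemma uniform_cover_sections:
  assumes sr: "1 \<le> s" "s < r" and \<sigma>: "\<sigma> \<subseteq> {1..n}" and cov: "uniform_cover s \<sigma> r \<sigma>s"
    and cK: "centered_convex_body n K"
  shows "(\<Prod>i<r. sec_vol n K (\<sigma>s i))
    \<le> (4 * exp 1) ^ (card \<sigma> * s) * sec_vol n K \<sigma> ^ s * vol n K ^ (r - s)"
proof -
  define f where "f = sect n K \<sigma>"
  define d where "d = card \<sigma>"
  define m where "m = r - s"
  have m: "1 \<le> m" "m \<le> r" "r - m = s" "real r = real m + real s" using sr by (auto simp: m_def)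
  have K: "convex_body n K" using cK by (simp add: centered_convex_body_def)
  have fin: "finite \<sigma>" by (rule finite_subset[OF \<sigma>]) simp
  obtain e where e: "e > 0" and nbhd: "\<And>x. (\<And>i. i \<in> {1..n} \<Longrightarrow> \<bar>x i\<bar> < e) \<Longrightarrow> restrict x {1..n} \<in> K"
    using centroid_interior[OF cK] by blast
  have F: "(\<lambda>y. sect n K \<sigma> (\<lambda>i. if i \<in> \<sigma> - {} then y i else 0)) = f"
    unfolding f_def by (intro ext sect_cong) auto
  have tf: "tame \<sigma> f" using sect_fold(1)[OF K \<sigma> empty_subsetI] unfolding F by (simp only: Diff_empty)
  have vol: "vol n K = (\<integral>y. f y \<partial>lebJ \<sigma>)"
    using sect_fold(2)[OF K \<sigma> empty_subsetI] sec_vol_empty[OF K] unfolding F by (simp only: Diff_empty)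
  \<comment> \<open>With no coordinate fixed, the slice is \<open>K\<close> itself. Positivity is
    needed to cancel the volume in the bound at the centroid.\<close>
  have vol_pos: "vol n K > 0"
  proof -
    have "vol n K = sect n K {} (\<lambda>_. 0)"
      using sect_fold(2)[OF K empty_subsetI empty_subsetI] sec_vol_empty[OF K]
      by (simp add: PiM_empty lebesgue_integral_count_space_finite)
    moreover have "sect n K {} (\<lambda>_. 0) > 0"
      by (rule sect_pos[OF K empty_subsetI e nbhd]) auto
    ultimately show ?thesis by simp
  qed
  have sec: "sec_vol n K \<sigma> = f (\<lambda>_. 0)"
    using sect_fold(2)[OF K \<sigma> subset_refl]
    by (simp add: PiM_empty lebesgue_integral_count_space_finite f_def)
  have fM: "f x \<le> 4 ^ d * f (\<lambda>_. 0)" for x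
    unfolding d_def
  proof (rule log_concave_le_at_centroid[OF fin _ tf _ _ _ e])
    show "log_concave f" unfolding f_def by (rule sect_log_concave[OF K \<sigma>])
    show "f (restrict x \<sigma>) = f x" for x unfolding f_def by (rule sect_restrict)
    show "(\<integral>x. x j * f x \<partial>lebJ \<sigma>) = 0" if "j \<in> \<sigma>" for j
      unfolding f_def coord_integral[OF K \<sigma> that]
      using cK \<sigma> that unfolding centered_convex_body_def by blast
    show "0 < (\<integral>x. f x \<partial>lebJ \<sigma>)" using vol vol_pos by simp
    show "0 < f x" if "\<And>j. j \<in> \<sigma> \<Longrightarrow> \<bar>x j\<bar> < e" for x
      unfolding f_def by (rule sect_pos[OF K \<sigma> e nbhd that])
  qed
  have \<sigma>s: "\<sigma>s i \<subseteq> \<sigma>" if "i < r" for i using cov that by (simp add: uniform_cover_def)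
  have "(\<Prod>i\<in>{..<r}. \<integral>y. f (\<lambda>j. if j \<in> \<sigma> - \<sigma>s i then y j else 0) \<partial>lebJ (\<sigma> - \<sigma>s i))
      \<le> (r / m) ^ (card \<sigma> * m) * (4 ^ d * f (\<lambda>_. 0)) ^ (r - m) * (\<integral>y. f y \<partial>lebJ \<sigma>) ^ m"
  proof (rule log_concave_uniform_cover[OF fin _ tf _ fM _ _ m(1,2)])
    show "log_concave f" unfolding f_def by (rule sect_log_concave[OF K \<sigma>])
    show "f (restrict x \<sigma>) = f x" for x unfolding f_def by (rule sect_restrict)
    show "tame (\<sigma> - \<sigma>s i) (\<lambda>y. f (\<lambda>j. if j \<in> \<sigma> - \<sigma>s i then y j else 0))" if "i \<in> {..<r}" for i
      unfolding f_def by (rule sect_fold(1)[OF K \<sigma>]) (use \<sigma>s that in auto)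
    \<comment> \<open>Each \<open>j\<close> lies in exactly \<open>s\<close> of the \<open>r\<close>
      sets, hence in \<open>r - s\<close> of the complements.\<close>
    show "card {i \<in> {..<r}. j \<in> \<sigma> - \<sigma>s i} = m" if j: "j \<in> \<sigma>" for j
    proof -
      have "{i \<in> {..<r}. j \<in> \<sigma> - \<sigma>s i} = {..<r} - {i. i < r \<and> j \<in> \<sigma>s i}" using j by auto
      also have "card \<dots> = r - card {i. i < r \<and> j \<in> \<sigma>s i}"
        by (subst card_Diff_subset) auto
      finally show ?thesis using cov j by (simp add: uniform_cover_def m_def)
    qed
  qed auto
  also have "(\<Prod>i\<in>{..<r}. \<integral>y. f (\<lambda>j. if j \<in> \<sigma> - \<sigma>s i then y j else 0) \<partial>lebJ (\<sigma> - \<sigma>s i)) =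
      (\<Prod>i<r. sec_vol n K (\<sigma>s i))"
    unfolding f_def by (intro prod.cong refl sect_fold(2)[OF K \<sigma>, symmetric] \<sigma>s) auto
  also have "(r / m) ^ (card \<sigma> * m) * (4 ^ d * f (\<lambda>_. 0)) ^ (r - m) * (\<integral>y. f y \<partial>lebJ \<sigma>) ^ m =
      (r / m) ^ (d * m) * (4 ^ (d * s) * sec_vol n K \<sigma> ^ s * vol n K ^ m)"
    by (simp add: m sec vol d_def power_mult_distrib power_mult)
  also have "\<dots> \<le> exp 1 ^ (d * s) * (4 ^ (d * s) * sec_vol n K \<sigma> ^ s * vol n K ^ m)"
  proof (rule mult_right_mono)
    \<comment> \<open>Writing the ratio as \<open>1 + s / m\<close> removes \<open>r\<close> and
      \<open>m\<close> from the constant: its power \<open>d * m\<close> is at most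
      \<open>exp 1 ^ (d * s)\<close>.\<close>
    have "real r / real m = 1 + s / m" using m by (simp add: add_divide_distrib)
    also have "\<dots> \<le> exp (s / m)" by (rule exp_ge_add_one_self)
    finally have "(r / m) ^ (d * m) \<le> exp (s / m) ^ (d * m)" by (intro power_mono) auto
    also have "\<dots> = exp 1 ^ (d * s)"
      using m by (simp flip: exp_of_nat_mult)
    finally show "(r / m) ^ (d * m) \<le> exp 1 ^ (d * s)" .
    show "0 \<le> 4 ^ (d * s) * sec_vol n K \<sigma> ^ s * vol n K ^ m"
      by (simp add: sec_vol_def vol_def)
  qed
  finally show ?thesis by (simp add: d_def m_def power_mult_distrib mult_ac)
qed

theorem theorem1p3:
  shows "\<exists>c0::real. c0 > 0 \<and>
    (\<forall>(n::nat) (r::nat) (s::nat) (\<sigma>::nat set) (\<sigma>s::nat \<Rightarrow> nat set) (d::nat)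
        (K::(nat \<Rightarrow> real) set).
      n \<ge> 2 \<longrightarrow> 1 \<le> s \<longrightarrow> s < r \<longrightarrow> \<sigma> \<subseteq> {1..n} \<longrightarrow> card \<sigma> = d \<longrightarrow> d < n \<longrightarrow>
      uniform_cover s \<sigma> r \<sigma>s \<longrightarrow> centered_convex_body n K \<longrightarrow>
      (\<Prod>i<r. sec_vol n K (\<sigma>s i))
         \<le> (c0 * real d) ^ (d * s) / (\<Prod>i<r. real (card (\<sigma>s i)) ^ card (\<sigma>s i))
           * sec_vol n K \<sigma> ^ s * vol n K ^ (r - s)
      \<and> (\<Prod>i<r. sec_vol n K (\<sigma>s i))
         \<le> (c0 * real r / real s) ^ (d * s) * sec_vol n K \<sigma> ^ s * vol n K ^ (r - s))"
proof (rule exI[of _ "4 * exp 1"], intro conjI allI impI)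
  show "(0::real) < 4 * exp 1" by simp
next
  fix n r s :: nat and \<sigma> :: "nat set" and \<sigma>s :: "nat \<Rightarrow> nat set" and d :: nat and K :: "(nat \<Rightarrow> real) set"
  assume sr: "1 \<le> s" "s < r" and \<sigma>: "\<sigma> \<subseteq> {1..n}" and d: "card \<sigma> = d"
    and cov: "uniform_cover s \<sigma> r \<sigma>s" and cK: "centered_convex_body n K"
  let ?c = "4 * exp 1 :: real" and ?V = "sec_vol n K \<sigma> ^ s * vol n K ^ (r - s)"
  have V: "?V \<ge> 0" by (simp add: sec_vol_def vol_def)
  have main: "(\<Prod>i<r. sec_vol n K (\<sigma>s i)) \<le> ?c ^ (d * s) * ?V"
    using uniform_cover_sections[OF sr \<sigma> cov cK] by (simp add: d mult.assoc)
  have fin: "finite \<sigma>" by (rule finite_subset[OF \<sigma>]) simp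
  have sub: "\<sigma>s i \<subseteq> \<sigma>" if "i < r" for i using cov that by (simp add: uniform_cover_def)
  \<comment> \<open>Double counting of the pairs of an element and a member of the cover that
    contains it.\<close>
  have count: "(\<Sum>i<r. card (\<sigma>s i)) = d * s"
  proof -
    have "(\<Sum>i<r. card {j\<in>\<sigma>. j \<in> \<sigma>s i}) = s * card \<sigma>"
      using cov fin by (intro sum_multicount) (auto simp: uniform_cover_def)
    moreover have "{j\<in>\<sigma>. j \<in> \<sigma>s i} = \<sigma>s i" if "i < r" for i using sub[OF that] by auto
    ultimately show ?thesis by (simp add: d mult.commute)
  qed
  have "(\<Prod>i<r. real (card (\<sigma>s i)) ^ card (\<sigma>s i)) \<le> (\<Prod>i<r. real d ^ card (\<sigma>s i))"
    using card_mono[OF fin sub] d by (intro prod_mono) (auto intro!: power_mono)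
  also have "\<dots> = real d ^ (d * s)" by (simp add: count flip: power_sum)
  finally have le: "(\<Prod>i<r. real (card (\<sigma>s i)) ^ card (\<sigma>s i)) \<le> real d ^ (d * s)" .
  \<comment> \<open>Empty members of the cover contribute \<open>0 ^ 0 = 1\<close>.\<close>
  have pos: "(\<Prod>i<r. real (card (\<sigma>s i)) ^ card (\<sigma>s i)) > 0"
  proof (intro prod_pos ballI)
    fix i show "0 < real (card (\<sigma>s i)) ^ card (\<sigma>s i)" by (cases "card (\<sigma>s i) = 0") auto
  qed
  have "?c ^ (d * s) * (\<Prod>i<r. real (card (\<sigma>s i)) ^ card (\<sigma>s i)) \<le> ?c ^ (d * s) * real d ^ (d * s)"
    using le by (intro mult_left_mono) auto
  \<comment> \<open>The fraction of \<open>d ^ (d * s)\<close> by the product is at least 1, so the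
    first bound is weaker than \<open>main\<close>.\<close>
  then have "?c ^ (d * s) \<le> (?c * real d) ^ (d * s) / (\<Prod>i<r. real (card (\<sigma>s i)) ^ card (\<sigma>s i))"
    using pos by (simp only: pos_le_divide_eq power_mult_distrib)
  from order_trans[OF main mult_right_mono[OF this V]]
  show "(\<Prod>i<r. sec_vol n K (\<sigma>s i))
         \<le> (4 * exp 1 * real d) ^ (d * s) / (\<Prod>i<r. real (card (\<sigma>s i)) ^ card (\<sigma>s i))
           * sec_vol n K \<sigma> ^ s * vol n K ^ (r - s)" by (simp only: mult.assoc)
  \<comment> \<open>Since \<open>s < r\<close>, the ratio \<open>r / s\<close> exceeds 1, so the
    second bound follows from \<open>main\<close> as well.\<close>
  have "?c ^ (d * s) \<le> (?c * real r / real s) ^ (d * s)"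
    using sr by (intro power_mono) (auto simp: field_simps)
  from order_trans[OF main mult_right_mono[OF this V]]
  show "(\<Prod>i<r. sec_vol n K (\<sigma>s i))
         \<le> (4 * exp 1 * real r / real s) ^ (d * s) * sec_vol n K \<sigma> ^ s * vol n K ^ (r - s)"
    by (simp only: mult.assoc)
qed

end
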